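(* Let $D=(V,A)$ be a skeletal directed acyclic graph. The following two descriptions define the same polytope $\mathbb{A}_D\subset\mathbb{R}^V$, and the sylvester fan $\mathcal{F}_{(V,\varnothing)}$ of $D$ is the normal fan of $\mathbb{A}_D$: (1) the intersection of the affine subspace $\mathbb{K}^\perp+\sum_{(u,v)\in A}e_v$ with the halfspaces $\{x\in\mathbb{R}^V : \langle\mathbf{1}_U,x\rangle\ge\iota_U\}$ for all biconnected subsets $U$ of $D$ which are connected in the transitive reduction of $D$; (2) the Minkowski sum of the faces $\triangle_\pi$ of the standard simplex $\triangle_V$, for all directed paths $\pi$ in the transitive reduction of $D$ whose endpoints are connected by an arc of $D$.
   Context: All directed graphs are finite and simple. A reorientation of a directed acyclic graph $D=(V,A)$ is a directed graph with the same underlying undirected graph, encoded by the set of arcs of $D$ that it reverses. $\mathcal{AR}_D$ is the poset of acyclic reorientations of $D$ ordered by inclusion of sets of reversed arcs. The transitive reduction of a directed acyclic graph is obtained by deleting all arcs whose endpoints are connected by a directed path of length at least $2$. A directed graph is a forest if its underlying undirected graph has no cycle. $D$ is vertebrate if the transitive reduction of every induced subgraph of $D$ is a forest; filled if for any directed path $\pi$ in $D$ whose endpoints are joined by an arc of $D$, all arcs joining any two vertices of $\pi$ belong to $D$; skeletal if vertebrate and filled. When $D$ is skeletal, $\mathcal{AR}_D$ is a lattice. A congruence of a lattice is an equivalence relation compatible with meets and joins; it contracts a join irreducible $J$ (covering a unique element $J_\star$) if $J_\star\equiv J$. Sylvester congruence. The transitive support of an arc $(u,v)$ of $D$ is the set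 of vertices appearing along directed paths in $D$ from $u$ to $v$. A rope of $D$ is a quadruple $(u,v,\nabla,\Delta)$ where $(u,v)\in A$ and $\nabla\sqcup\Delta$ is a partition of the transitive support of $(u,v)$ minus $\{u,v\}$. For a rope $\rho=(u,v,\nabla,\Delta)$, let $I_\vee(\rho)$ be the acyclic reorientation of $D$ where an arc $(w,w')$ of $D$ is reversed if and only if $w\in\Delta\cup\{u\}$ and $w'\in\nabla\cup\{v\}$; $\rho\mapsto I_\vee(\rho)$ is a bijection from ropes of $D$ to join irreducibles of $\mathcal{AR}_D$. The sylvester congruence $\equiv_{(V,\varnothing)}$ is the unique congruence of $\mathcal{AR}_D$ whose uncontracted join irreducibles are exactly the $I_\vee(\rho)$ for the ropes $\rho=(u,v,\nabla,\varnothing)$ (i.e. with $\Delta=\varnothing$). Fans. For an acyclic reorientation $E$ of $D$, let $\mathbb{C}_E=\{x\in\mathbb{R}^V : x_u\le x_v\text{ for all arcs }(u,v)\text{ of }E\}$. The sylvester fan $\mathcal{F}_{(V,\varnothing)}$ is the complete fan in $\mathbb{R}^V$ whose chambers are the unions $\bigcup_{E\in X}\mathbb{C}_E$ over the classes $X$ of $\equiv_{(V,\varnothing)}$. The normal fan of a polytope $P\subset\mathbb{R}^V$ is formed by the normal cones of its faces, where the normal cone of a face $F$ is the (closed) cone of vectors $v$ for which $x\mapsto\langle v,x\rangle$ is maximized over $P$ at all points of $F$. Notation. $(e_v)_{v\in V}$ is the standard basis of $\mathbb{R}^V$ and $\mathbf{1}_U=\sum_{u\in U}e_u$ for $U\subseteq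 V$. $\mathbb{K}$ is the linear span of the vectors $\mathbf{1}_K$ for the connected components $K$ of $D$, and $\mathbb{K}^\perp$ its orthogonal complement. A biconnected subset of $D$ is a non-empty subset $U\subset V$ that is connected in (the underlying undirected graph of) $D$ and whose complement in its connected component of $D$ is also non-empty and connected. $\iota_U$ is the number of arcs of $D$ with both endpoints in $U$. For a path $\pi$, $\triangle_\pi=\mathrm{conv}\{e_w : w\text{ a vertex of }\pi\}$. *)

theory Defs
  imports "HOL-Analysis.Analysis" "HOL-Algebra.Lattice" "HOL-Library.Set_Algebras"
begin

text \<open>
  A directed graph is given by its set of arcs \<open>A\<close>; its vertex set is the whole finite type
  \<open>'v\<close>, so that \<open>real ^ 'v\<close> is the ambient space. Acyclicity is HOL's \<open>acyclic A\<close>, which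
  already excludes loops and opposite arcs.
\<close>

type_synonym 'v digraph = "('v \<times> 'v) set"

section \<open>Directed graphs\<close>

definition induced :: "'v digraph \<Rightarrow> 'v set \<Rightarrow> 'v digraph" where
  "induced A U = A \<inter> (U \<times> U)"

definition dipath :: "'v digraph \<Rightarrow> 'v list \<Rightarrow> bool" where
  "dipath A p \<longleftrightarrow> p \<noteq> [] \<and> distinct p \<and> successively (\<lambda>u v. (u, v) \<in> A) p"

text \<open>A path of length at least 2 is one with at least three vertices.\<close>

definition transitive_reduction :: "'v digraph \<Rightarrow> 'v digraph" where
  "transitive_reduction A =
     {(u, v) \<in> A. \<not> (\<exists>p. dipath A p \<and> length p \<ge> 3 \<and> hd p = u \<and> last p = v)}"

definition underlying :: "'v digraph \<Rightarrow> 'v digraph" where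
  "underlying A = A \<union> A\<inverse>"

definition undirected_forest :: "'v digraph \<Rightarrow> bool" where
  "undirected_forest A \<longleftrightarrow>
     \<not> (\<exists>p. length p \<ge> 3 \<and> dipath (underlying A) p \<and> (last p, hd p) \<in> underlying A)"

definition vertebrate :: "'v digraph \<Rightarrow> bool" where
  "vertebrate A \<longleftrightarrow> (\<forall>U. undirected_forest (transitive_reduction (induced A U)))"

text \<open>In an acyclic graph an arc joining two vertices of a path points forward along the path.\<close>

definition filled :: "'v digraph \<Rightarrow> bool" where
  "filled A \<longleftrightarrow>
     (\<forall>p. dipath A p \<and> (hd p, last p) \<in> A \<longrightarrow>
        (\<forall>i j. i < j \<and> j < length p \<longrightarrow> (p ! i, p ! j) \<in> A))"

definition skeletal :: "'v digraph \<Rightarrow> bool" where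
  "skeletal A \<longleftrightarrow> vertebrate A \<and> filled A"

definition connected_in :: "'v digraph \<Rightarrow> 'v set \<Rightarrow> bool" where
  "connected_in A U \<longleftrightarrow> (\<forall>u\<in>U. \<forall>v\<in>U. (u, v) \<in> (underlying (induced A U))\<^sup>*)"

definition graph_components :: "'v digraph \<Rightarrow> 'v set set" where
  "graph_components A = UNIV // (underlying A)\<^sup>*"

definition biconnected :: "'v digraph \<Rightarrow> 'v set \<Rightarrow> bool" where
  "biconnected A U \<longleftrightarrow>
     U \<noteq> {} \<and> connected_in A U \<and>
     (\<exists>K\<in>graph_components A. U \<subseteq> K \<and> K - U \<noteq> {} \<and> connected_in A (K - U))"


section \<open>Lattice congruences\<close>

definition lattice_congruence :: "('a, 'b) gorder_scheme \<Rightarrow> ('a \<times> 'a) set \<Rightarrow> bool" where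
  "lattice_congruence L r \<longleftrightarrow>
     equiv (carrier L) r \<and>
     (\<forall>x x' y y'. (x, x') \<in> r \<and> (y, y') \<in> r \<longrightarrow>
        (x \<squnion>\<^bsub>L\<^esub> y, x' \<squnion>\<^bsub>L\<^esub> y') \<in> r \<and> (x \<sqinter>\<^bsub>L\<^esub> y, x' \<sqinter>\<^bsub>L\<^esub> y') \<in> r)"

definition covered_by :: "('a, 'b) gorder_scheme \<Rightarrow> 'a \<Rightarrow> 'a \<Rightarrow> bool" where
  "covered_by L x y \<longleftrightarrow>
     x \<in> carrier L \<and> y \<in> carrier L \<and> x \<sqsubset>\<^bsub>L\<^esub> y \<and>
     \<not> (\<exists>z\<in>carrier L. x \<sqsubset>\<^bsub>L\<^esub> z \<and> z \<sqsubset>\<^bsub>L\<^esub> y)"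

definition join_irreducible :: "('a, 'b) gorder_scheme \<Rightarrow> 'a \<Rightarrow> bool" where
  "join_irreducible L J \<longleftrightarrow> J \<in> carrier L \<and> (\<exists>!x. covered_by L x J)"

definition lower_cover :: "('a, 'b) gorder_scheme \<Rightarrow> 'a \<Rightarrow> 'a" where
  "lower_cover L J = (THE x. covered_by L x J)"

definition contracts :: "('a, 'b) gorder_scheme \<Rightarrow> ('a \<times> 'a) set \<Rightarrow> 'a \<Rightarrow> bool" where
  "contracts L r J \<longleftrightarrow> (lower_cover L J, J) \<in> r"


section \<open>Acyclic reorientations and the sylvester congruence\<close>

text \<open>A reorientation is encoded by the set \<open>R \<subseteq> A\<close> of arcs that it reverses.\<close>

definition reorient :: "'v digraph \<Rightarrow> 'v digraph \<Rightarrow> 'v digraph" where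
  "reorient A R = (A - R) \<union> R\<inverse>"

definition acyclic_reorientations :: "'v digraph \<Rightarrow> 'v digraph set" where
  "acyclic_reorientations A = {R. R \<subseteq> A \<and> acyclic (reorient A R)}"

definition AR :: "'v digraph \<Rightarrow> 'v digraph gorder" where
  "AR A = \<lparr>carrier = acyclic_reorientations A, eq = (=), le = (\<subseteq>)\<rparr>"

definition transitive_support :: "'v digraph \<Rightarrow> 'v \<Rightarrow> 'v \<Rightarrow> 'v set" where
  "transitive_support A u v = \<Union> {set p |p. dipath A p \<and> hd p = u \<and> last p = v}"

definition rope :: "'v digraph \<Rightarrow> 'v \<Rightarrow> 'v \<Rightarrow> 'v set \<Rightarrow> 'v set \<Rightarrow> bool" where
  "rope A u v N D \<longleftrightarrow>
     (u, v) \<in> A \<and> N \<inter> D = {} \<and> N \<union> D = transitive_support A u v - {u, v}"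

definition rope_join_irreducible ::
    "'v digraph \<Rightarrow> 'v \<Rightarrow> 'v \<Rightarrow> 'v set \<Rightarrow> 'v set \<Rightarrow> 'v digraph" where
  "rope_join_irreducible A u v N D = {(w, w') \<in> A. w \<in> D \<union> {u} \<and> w' \<in> N \<union> {v}}"

definition sylvester_congruence :: "'v digraph \<Rightarrow> ('v digraph \<times> 'v digraph) set" where
  "sylvester_congruence A =
     (THE r. lattice_congruence (AR A) r \<and>
        {J. join_irreducible (AR A) J \<and> \<not> contracts (AR A) r J} =
        {rope_join_irreducible A u v N {} |u v N. rope A u v N {}})"


section \<open>Fans\<close>

definition reorientation_cone :: "'v::finite digraph \<Rightarrow> 'v digraph \<Rightarrow> (real ^ 'v) set" where
  "reorientation_cone A R = {x. \<forall>(u, v)\<in>reorient A R. x $ u \<le> x $ v}"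

definition sylvester_chambers :: "'v::finite digraph \<Rightarrow> (real ^ 'v) set set" where
  "sylvester_chambers A =
     {\<Union>R\<in>X. reorientation_cone A R |X. X \<in> acyclic_reorientations A // sylvester_congruence A}"

text \<open>
  A fan is a set of cones. The complete fan with prescribed chambers (maximal cones) consists of
  all faces of these chambers; the empty set, which is a \<open>face_of\<close> everything, is not a cone of
  the fan.
\<close>

definition sylvester_fan :: "'v::finite digraph \<Rightarrow> (real ^ 'v) set set" where
  "sylvester_fan A = {F. F \<noteq> {} \<and> (\<exists>C\<in>sylvester_chambers A. F face_of C)}"

definition normal_cone :: "'a::euclidean_space set \<Rightarrow> 'a set \<Rightarrow> 'a set" where
  "normal_cone P F = {v. \<forall>x\<in>F. \<forall>y\<in>P. v \<bullet> y \<le> v \<bullet> x}"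

definition normal_fan :: "'a::euclidean_space set \<Rightarrow> 'a set set" where
  "normal_fan P = {normal_cone P F |F. F face_of P \<and> F \<noteq> {}}"


section \<open>The two descriptions of the polytope\<close>

definition indicator_vec :: "'v::finite set \<Rightarrow> real ^ 'v" where
  "indicator_vec U = (\<Sum>u\<in>U. axis u 1)"

definition component_space :: "'v::finite digraph \<Rightarrow> (real ^ 'v) set" where
  "component_space A = span (indicator_vec ` graph_components A)"

definition arc_count :: "'v digraph \<Rightarrow> 'v set \<Rightarrow> nat" where
  "arc_count A U = card (induced A U)"

definition associahedron_H :: "'v::finite digraph \<Rightarrow> (real ^ 'v) set" where
  "associahedron_H A =
     {x + (\<Sum>(u, v)\<in>A. axis v 1) |x. x \<in> (component_space A)\<^sup>\<bottom>} \<inter>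
     (\<Inter>U\<in>{U. biconnected A U \<and> connected_in (transitive_reduction A) U}.
        {x. indicator_vec U \<bullet> x \<ge> real (arc_count A U)})"

definition path_simplex :: "'v::finite list \<Rightarrow> (real ^ 'v) set" where
  "path_simplex p = convex hull {axis w 1 |w. w \<in> set p}"

text \<open>The sum below is the Minkowski sum of sets, as provided by \<open>Set_Algebras\<close>.\<close>

definition associahedron_M :: "'v::finite digraph \<Rightarrow> (real ^ 'v) set" where
  "associahedron_M A =
     (\<Sum>p\<in>{p. dipath (transitive_reduction A) p \<and> (hd p, last p) \<in> A}. path_simplex p)"

end

theory Submission
  imports Defs
begin

text \<open>
  The support of an arc \<open>(u, w)\<close> of a skeletal graph is a clique, so an acyclic reorientation
  orders it totally; let its sink be the last vertex. A linear functional in the cone of a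
  reorientation \<open>R\<close> is maximised over the Minkowski sum by the sum of the unit vectors at these
  sinks. Two reorientations have the same sinks if and only if the same \<^emph>\<open>first\<close> vertices \<open>u\<close> are
  sinks, which is compatible with meets, and if and only if the same \<^emph>\<open>last\<close> vertices \<open>w\<close> are
  sinks, which is compatible with joins; hence having the same sinks is a lattice congruence, and
  it is the sylvester one. A point of the intersection of halfspaces lies in the Minkowski sum
  because the level sets of a linear functional decompose, first into components of the
  transitive reduction and then through the components of the complement of each of these, into
  sets whose inequalities are tight at the maximising vertex.
\<close>

section \<open>Directed paths and undirected connectivity\<close>

text \<open>Vertebrateness makes supports cliques by excluding induced four-cycles; filledness
  reduces the intermediate vertices of an arc to those on paths of length two. Acyclicity thereby
  becomes a condition on triangles (\<open>biclosed\<close>), as for inversion sets of permutations.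
  Meets and joins of reorientations have no convenient formula, so only their universal properties
  are used: \<open>u\<close> is the sink of the support of \<open>(u, w)\<close> if and only if the
  reorientation contains a fixed biclosed set, and \<open>w\<close> is the sink if and only if it
  avoids another one. Each kind of condition is transparent for one operation only, whence the
  translation between them.

  The obstacle in the halfspace part is that few sets carry an inequality, while a level set need be
  neither connected nor coconnected. Connectedness of \<open>U\<close> in the reduction ensures that
  the arcs inside \<open>U\<close> are those whose whole support is in \<open>U\<close>, so that the
  right-hand side is the exact minimum of \<open>indicator_vec U\<close> over the Minkowski sum.
  Pieces of a level set must therefore be taken in the reduction, but pieces of their complements in
  \<open>A\<close> itself.\<close>

lemma dipath_mono: "dipath A p \<Longrightarrow> A \<subseteq> B \<Longrightarrow> dipath B p"
  unfolding dipath_def by (auto elim: successively_mono)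

lemma dipath_append:
  assumes "dipath A (p @ q)"
  shows "p \<noteq> [] \<Longrightarrow> dipath A p" and "q \<noteq> [] \<Longrightarrow> dipath A q"
  using assms by (auto simp: dipath_def successively_append_iff)

lemma dipath_middle_arc: "dipath A (p @ x # y # q) \<Longrightarrow> (x, y) \<in> A"
  by (auto simp: dipath_def successively_append_iff)

lemma ex_dipath_if_rtrancl:
  assumes "(u, v) \<in> A\<^sup>*"
  shows "\<exists>p. dipath A p \<and> hd p = u \<and> last p = v"
  using assms
proof (induction rule: rtrancl_induct)
  case base
  then show ?case by (intro exI[of _ "[u]"]) (auto simp: dipath_def)
next
  case (step y z)
  then obtain p where p: "dipath A p" "hd p = u" "last p = y" by blast
  show ?case
  proof (cases "z \<in> set p")
    case True
    then obtain xs ys where "p = xs @ z # ys" by (meson split_list)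
    with p show ?thesis
      by (intro exI[of _ "xs @ [z]"])
         (auto simp: dipath_def successively_append_iff hd_append split: if_splits)
  next
    case False
    with p step(2) show ?thesis
      by (intro exI[of _ "p @ [z]"]) (auto simp: dipath_def successively_append_iff)
  qed
qed

lemma dipath_imp_trancl:
  assumes "dipath A (x # p)" "y \<in> set p"
  shows "(x, y) \<in> A\<^sup>+"
  using assms
proof (induction p arbitrary: x)
  case (Cons z p)
  have 1: "(x, z) \<in> A" "dipath A (z # p)"
    using Cons.prems(1) by (auto simp: dipath_def)
  show ?case
  proof (cases "y = z")
    case False
    then have "(z, y) \<in> A\<^sup>+" using Cons 1 by auto
    with 1 show ?thesis by auto
  qed (use 1 in auto)
qed simp

lemma underlying_induced_rtrancl_mono:
  assumes "(u, v) \<in> (underlying (induced A U))\<^sup>*" "A \<subseteq> B" "U \<subseteq> W"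
  shows "(u, v) \<in> (underlying (induced B W))\<^sup>*"
proof -
  have "underlying (induced A U) \<subseteq> underlying (induced B W)"
    using assms by (auto simp: underlying_def induced_def)
  then show ?thesis using assms(1) rtrancl_mono by blast
qed

lemma underlying_induced_rtrancl_sym:
  "(u, v) \<in> (underlying (induced A U))\<^sup>* \<Longrightarrow> (v, u) \<in> (underlying (induced A U))\<^sup>*"
proof -
  have "sym (underlying (induced A U))" by (auto simp: underlying_def sym_def)
  then show "(u, v) \<in> (underlying (induced A U))\<^sup>* \<Longrightarrow> (v, u) \<in> (underlying (induced A U))\<^sup>*"
    using sym_rtrancl symD by metis
qed

lemma connected_in_set_dipath:
  assumes "dipath A p"
  shows "connected_in A (set p)"
proof -
  have "(hd p, x) \<in> (underlying (induced A (set p)))\<^sup>*" if "dipath A p" "x \<in> set p" for p x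
    using that
  proof (induction p arbitrary: x rule: rev_induct)
    case (snoc y p)
    show ?case
    proof (cases "p = []")
      case False
      have p: "dipath A p" "(last p, y) \<in> A"
        using False snoc.prems by (auto simp: dipath_def successively_append_iff)
      have 1: "(hd p, z) \<in> (underlying (induced A (set (p @ [y]))))\<^sup>*" if "z \<in> set p" for z
        using snoc.IH[OF p(1) that] by (rule underlying_induced_rtrancl_mono) auto
      have "(last p, y) \<in> underlying (induced A (set (p @ [y])))"
        using p False by (auto simp: underlying_def induced_def)
      with 1[of "last p"] False have "(hd p, y) \<in> (underlying (induced A (set (p @ [y]))))\<^sup>*"
        by auto
      with 1 snoc.prems False show ?thesis by auto
    qed (use snoc in auto)
  qed simp
  then show ?thesis
    unfolding connected_in_def using assms underlying_induced_rtrancl_sym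
    by (meson rtrancl_trans)
qed

text \<open>The reflexive closure also relates vertices outside \<open>U\<close> to themselves; the
  intersection with \<open>U \<times> U\<close> removes these pairs, so that the classes are the
  components of the induced subgraph.\<close>

lemma equiv_underlying_induced:
  "equiv U ((underlying (induced A U))\<^sup>* \<inter> U \<times> U)"
  by (rule equivI)
     (auto simp: refl_on_def sym_def trans_def underlying_induced_rtrancl_sym)

lemma sum_quotient:
  assumes "finite U" "equiv U r"
  shows "sum f U = (\<Sum>C\<in>U // r. sum f C)"
proof -
  have "sum f (\<Union>(U // r)) = (\<Sum>C\<in>U // r. sum f C)"
    using assms quotient_disj[OF assms(2)] finite_equiv_class
    by (subst sum.Union_disjoint) (auto simp: equiv_def)
  then show ?thesis using Union_quotient[OF assms(2)] by simp
qed

lemma induced_quotient_properties: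
  assumes "C \<in> U // ((underlying (induced A U))\<^sup>* \<inter> U \<times> U)"
  shows "C \<subseteq> U" "C \<noteq> {}" "connected_in A C"
    and "\<And>x y. x \<in> C \<Longrightarrow> y \<in> U \<Longrightarrow> (x, y) \<in> (underlying (induced A U))\<^sup>* \<Longrightarrow> y \<in> C"
proof -
  let ?E = "underlying (induced A U)"
  obtain z where z: "z \<in> U" "C = {y \<in> U. (z, y) \<in> ?E\<^sup>*}"
    using assms by (auto simp: quotient_def Image_def)
  show "C \<subseteq> U" "C \<noteq> {}" using z by auto
  show cl: "y \<in> C" if "x \<in> C" "y \<in> U" "(x, y) \<in> ?E\<^sup>*" for x y
    using that z by auto
  \<comment> \<open>Connectedness is wanted inside \<open>C\<close>, not merely inside
    \<open>U\<close>: a walk in \<open>U\<close> that starts in \<open>C\<close> never leaves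
    \<open>C\<close>.\<close>
  have "(x, y) \<in> (underlying (induced A C))\<^sup>*" if "x \<in> C" "(x, y) \<in> ?E\<^sup>*" for x y
    using that(2)
  proof (induction rule: rtrancl_induct)
    case (step y y')
    have "y \<in> U" "y' \<in> U" using step(2) by (auto simp: underlying_def induced_def)
    then have "y \<in> C" "y' \<in> C"
      using cl[OF that(1)] step(1,2) by (auto intro: rtrancl_into_rtrancl)
    then have "(y, y') \<in> underlying (induced A C)"
      using step(2) by (auto simp: underlying_def induced_def)
    with step(3) show ?case by simp
  qed simp
  moreover have "(x, y) \<in> ?E\<^sup>*" if "x \<in> C" "y \<in> C" for x y
    using that z underlying_induced_rtrancl_sym[of z x A U] by auto
  ultimately show "connected_in A C" unfolding connected_in_def by blast
qed

section \<open>Skeletal graphs\<close>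

locale skeletal_dag =
  fixes A :: "'v::finite digraph"
  assumes acyclic: "acyclic A"
    and skeletal: "skeletal A"
begin

abbreviation "supp \<equiv> transitive_support A"

section \<open>Arcs and their supports: cliques and convexity\<close>

lemma arc_irrefl: "(u, u) \<notin> A"
  using acyclic by (auto simp: acyclic_def)

lemma arc_antisym: "(u, v) \<in> A \<Longrightarrow> (v, u) \<notin> A"
  using acyclic by (meson acyclic_def trancl.intros)

lemma no_triangle: "(u, v) \<in> A \<Longrightarrow> (v, w) \<in> A \<Longrightarrow> (w, u) \<notin> A"
  using acyclic by (meson acyclic_def trancl.intros)

lemma wf_arcs: "wf A" and wf_arcs_converse: "wf (A\<inverse>)"
  using acyclic finite_acyclic_wf finite_acyclic_wf_converse finite by blast+

lemma filledD:
  "dipath A p \<Longrightarrow> (hd p, last p) \<in> A \<Longrightarrow> i < j \<Longrightarrow> j < length p \<Longrightarrow> (p ! i, p ! j) \<in> A"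
  using skeletal unfolding skeletal_def filled_def by blast

lemma path4_arcs:
  assumes "(u, v) \<in> A" "(v, w) \<in> A" "(w, z) \<in> A" "(u, z) \<in> A"
  shows "(u, w) \<in> A" "(v, z) \<in> A"
proof -
  have ne: "u \<noteq> v" "u \<noteq> w" "u \<noteq> z" "v \<noteq> w" "v \<noteq> z" "w \<noteq> z"
    using assms arc_irrefl arc_antisym by auto
  then have "dipath A [u, v, w, z]"
    using assms by (auto simp: dipath_def)
  then show "(u, w) \<in> A" "(v, z) \<in> A"
    using filledD[of "[u, v, w, z]" 0 2] filledD[of "[u, v, w, z]" 1 3] assms(4) by auto
qed

text \<open>If \<open>v\<close> and \<open>t\<close> were not adjacent, none of the four arcs would
  be transitive in the subgraph induced on \<open>{u, v, t, w}\<close>, so its transitive reduction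
  would contain the cycle \<open>u, v, w, t\<close>.\<close>

lemma diamond:
  assumes "(u, v) \<in> A" "(v, w) \<in> A" "(u, t) \<in> A" "(t, w) \<in> A" "v \<noteq> t"
  shows "(v, t) \<in> A \<or> (t, v) \<in> A"
proof (rule ccontr)
  assume non: "\<not> ?thesis"
  let ?I = "induced A {u, v, t, w}"
  have forest: "undirected_forest (transitive_reduction ?I)"
    using skeletal unfolding skeletal_def vertebrate_def by blast
  have ne: "u \<noteq> v" "u \<noteq> w" "u \<noteq> t" "v \<noteq> w" "t \<noteq> w"
    using assms arc_irrefl arc_antisym by auto
  have nonarcs: "(v, u) \<notin> A" "(w, v) \<notin> A" "(t, u) \<notin> A" "(w, t) \<notin> A" "(w, u) \<notin> A"
    using assms arc_antisym no_triangle by blast+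
  \<comment> \<open>A longer path from \<open>x\<close> to \<open>y\<close> leaves \<open>x\<close>
    for a vertex other than \<open>y\<close> and enters \<open>y\<close> from a vertex other than
    \<open>x\<close>. Without an arc between \<open>v\<close> and \<open>t\<close>, nothing but
    \<open>u\<close> enters \<open>v\<close> or \<open>t\<close>, and these two lead only to
    \<open>w\<close>.\<close>
  have no: "\<not> (\<exists>p. dipath ?I p \<and> length p \<ge> 3 \<and> hd p = x \<and> last p = y)"
    if "(x, y) \<in> {(u, v), (v, w), (u, t), (t, w)}" for x y
  proof
    assume "\<exists>p. dipath ?I p \<and> length p \<ge> 3 \<and> hd p = x \<and> last p = y"
    then obtain p where p: "dipath ?I p" "length p \<ge> 3" "hd p = x" "last p = y" by blast
    then obtain b q where pq: "p = x # b # q" "q \<noteq> []"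
      by (auto simp: numeral_3_eq_3 Suc_le_length_iff)
    then obtain q'' where q'': "q = q'' @ [y]"
      using p(4) by (metis append_butlast_last_id last_ConsR list.distinct(1))
    obtain q' c where "b # q'' = q' @ [c]"
      by (metis append_butlast_last_id list.distinct(1))
    then have q: "b # q = q' @ [c, y]" using q'' by simp
    have "(x, b) \<in> ?I"
      using p(1) pq by (auto simp: dipath_def)
    moreover have "(c, y) \<in> ?I"
      using p(1) pq q dipath_middle_arc[of ?I "x # q'" c y "[]"] by (auto simp: dipath_def)
    moreover have "b \<noteq> y" "x \<noteq> c" "x \<noteq> b"
    proof -
      have "distinct (x # b # q)" "distinct (x # q' @ [c, y])"
        using p(1) pq q by (simp_all add: dipath_def)
      then show "b \<noteq> y" "x \<noteq> c" "x \<noteq> b"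
        using p(4) pq by auto
    qed
    ultimately show False
      using that non nonarcs ne arc_irrefl assms by (auto simp: induced_def)
  qed
  have "{(u, v), (v, w), (u, t), (t, w)} \<subseteq> transitive_reduction ?I"
    using no assms unfolding transitive_reduction_def by (auto simp: induced_def)
  then have "dipath (underlying (transitive_reduction ?I)) [u, v, w, t]"
    and "(t, u) \<in> underlying (transitive_reduction ?I)"
    using ne assms(5) by (auto simp: dipath_def underlying_def)
  then have "3 \<le> length [u, v, w, t] \<and> dipath (underlying (transitive_reduction ?I)) [u, v, w, t] \<and>
      (last [u, v, w, t], hd [u, v, w, t]) \<in> underlying (transitive_reduction ?I)"
    by simp
  then show False
    using forest unfolding undirected_forest_def by blast
qed

lemma supp_dipath:
  assumes "dipath A p" "(hd p, last p) \<in> A" "t \<in> set p"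
  shows "t = hd p \<or> t = last p \<or> (hd p, t) \<in> A \<and> (t, last p) \<in> A"
proof -
  obtain i where i: "i < length p" "t = p ! i" using assms(3) by (metis in_set_conv_nth)
  have p: "hd p = p ! 0" "last p = p ! (length p - 1)"
    using i by (cases p; simp add: hd_conv_nth last_conv_nth)+
  consider "i = 0" | "i = length p - 1" | "0 < i" "i < length p - 1" using i by linarith
  then show ?thesis
  proof cases
    case 3
    then show ?thesis
      using filledD[OF assms(1,2), of 0 i] filledD[OF assms(1,2), of i "length p - 1"] i p by auto
  qed (use i p in auto)
qed

text \<open>By filledness every inner vertex of a directed path from \<open>u\<close> to
  \<open>w\<close> is joined to both ends, so paths with at most one inner vertex already give the
  whole support.\<close>

lemma supp_eq:
  assumes "(u, w) \<in> A"
  shows "supp u w = {u, w} \<union> {v. (u, v) \<in> A \<and> (v, w) \<in> A}"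
proof
  show "supp u w \<subseteq> {u, w} \<union> {v. (u, v) \<in> A \<and> (v, w) \<in> A}"
    using supp_dipath assms unfolding transitive_support_def by blast
  have "t \<in> supp u w" if "dipath A p" "hd p = u" "last p = w" "t \<in> set p" for p t
    using that unfolding transitive_support_def by blast
  note 1 = this[of "[u, w]"] this[of "[u, v, w]" v for v]
  have "u \<noteq> w" using assms arc_irrefl by blast
  then have "u \<in> supp u w" "w \<in> supp u w"
    using 1(1)[of u] 1(1)[of w] assms by (simp_all add: dipath_def)
  moreover have "v \<in> supp u w" if "(u, v) \<in> A" "(v, w) \<in> A" for v
  proof -
    have "u \<noteq> v" "v \<noteq> w" using that arc_irrefl by blast+
    then show ?thesis using 1(2)[of v] that \<open>u \<noteq> w\<close> by (simp add: dipath_def)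
  qed
  ultimately show "{u, w} \<union> {v. (u, v) \<in> A \<and> (v, w) \<in> A} \<subseteq> supp u w"
    by blast
qed

lemma supp_ends: "(u, w) \<in> A \<Longrightarrow> u \<in> supp u w" "(u, w) \<in> A \<Longrightarrow> w \<in> supp u w"
  by (auto simp: supp_eq)

lemma supp_clique:
  assumes "(u, w) \<in> A" "s \<in> supp u w" "t \<in> supp u w" "s \<noteq> t"
  shows "(s, t) \<in> A \<or> (t, s) \<in> A"
  using assms diamond[of u s w t] by (auto simp: supp_eq)

text \<open>For \<open>x\<close> between \<open>s\<close> and \<open>t\<close>, filledness of the
  path \<open>s, x, t, w\<close> gives the arc from \<open>x\<close> to \<open>w\<close>, and that
  of \<open>u, s, x, t\<close> gives the arc from \<open>u\<close> to \<open>x\<close>; the cases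
  \<open>s = u\<close> and \<open>t = w\<close> are immediate.\<close>

lemma supp_convex:
  assumes "(u, w) \<in> A" "s \<in> supp u w" "t \<in> supp u w" "(s, t) \<in> A"
  shows "supp s t \<subseteq> supp u w"
proof
  fix x assume "x \<in> supp s t"
  then have x: "x = s \<or> x = t \<or> (s, x) \<in> A \<and> (x, t) \<in> A" using supp_eq assms by auto
  have s: "s = u \<or> (u, s) \<in> A" "s \<noteq> w" and t: "t = w \<or> (t, w) \<in> A" "t \<noteq> u"
    using assms arc_antisym arc_irrefl by (auto simp: supp_eq)
  have tw: "(s, w) \<in> A" and ut: "(u, t) \<in> A"
    using assms s t by (auto simp: supp_eq)
  show "x \<in> supp u w"
  proof (cases "x = s \<or> x = t")
    case False
    with x have sx: "(s, x) \<in> A" "(x, t) \<in> A" by auto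
    have "(x, w) \<in> A" using t(1) sx path4_arcs(2)[OF sx _ tw] by auto
    moreover have "(u, x) \<in> A" using s(1) sx path4_arcs(1)[OF _ sx ut] by auto
    ultimately show ?thesis using assms(1) by (simp add: supp_eq)
  qed (use assms in auto)
qed

text \<open>By filledness, the second vertex of a longer path from \<open>u\<close> to
  \<open>w\<close> is joined to \<open>w\<close>, so transitivity of an arc is always witnessed by a
  triangle.\<close>

lemma not_in_reduction:
  assumes "(u, w) \<in> A" 
  shows "(u, w) \<notin> transitive_reduction A \<longleftrightarrow> (\<exists>t. (u, t) \<in> A \<and> (t, w) \<in> A)"
proof
  assume "(u, w) \<notin> transitive_reduction A"
  then obtain p where p: "dipath A p" "length p \<ge> 3" "hd p = u" "last p = w"
    using assms by (auto simp: transitive_reduction_def)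
  then have h: "hd p = p ! 0" "last p = p ! (length p - 1)"
    by (auto simp: hd_conv_nth last_conv_nth dipath_def)
  show "\<exists>t. (u, t) \<in> A \<and> (t, w) \<in> A"
    using filledD[of p 0 1] filledD[of p 1 "length p - 1"] p h assms by (intro exI[of _ "p ! 1"]) auto
next
  assume "\<exists>t. (u, t) \<in> A \<and> (t, w) \<in> A"
  then obtain t where t: "(u, t) \<in> A" "(t, w) \<in> A" by blast
  then have "dipath A [u, t, w]" using assms arc_irrefl by (auto simp: dipath_def)
  then show "(u, w) \<notin> transitive_reduction A"
    unfolding transitive_reduction_def by (auto intro!: exI[of _ "[u, t, w]"])
qed

lemma reduction_subset: "transitive_reduction A \<subseteq> A"
  by (auto simp: transitive_reduction_def)

text \<open>A transitive arc is split at an intermediate vertex \<open>t\<close>. By filledness the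
  intermediate vertices of both halves are intermediate for \<open>(u, w)\<close>, and
  \<open>t\<close> itself is lost in both, so their number drops.\<close>

lemma arc_in_reduction_trancl:
  assumes "(u, w) \<in> A"
  shows "(u, w) \<in> (transitive_reduction A)\<^sup>+"
  using assms
proof (induction "card {t. (u, t) \<in> A \<and> (t, w) \<in> A}" arbitrary: u w rule: less_induct)
  case less
  show ?case
  proof (cases "(u, w) \<in> transitive_reduction A")
    case False
    then obtain t where t: "(u, t) \<in> A" "(t, w) \<in> A" using not_in_reduction less.prems by blast
    let ?B = "\<lambda>u w. {t. (u, t) \<in> A \<and> (t, w) \<in> A}"
    have "?B u t \<subseteq> ?B u w" "?B t w \<subseteq> ?B u w"
      using path4_arcs(2)[OF _ _ t(2) less.prems] path4_arcs(1)[OF t(1) _ _ less.prems] by auto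
    moreover have "t \<in> ?B u w" "t \<notin> ?B u t" "t \<notin> ?B t w"
      using t arc_irrefl by auto
    ultimately have "?B u t \<subset> ?B u w" "?B t w \<subset> ?B u w"
      by blast+
    then have "card (?B u t) < card (?B u w)" "card (?B t w) < card (?B u w)"
      by (auto intro!: psubset_card_mono)
    then have "(u, t) \<in> (transitive_reduction A)\<^sup>+" "(t, w) \<in> (transitive_reduction A)\<^sup>+"
      using less.hyps t by blast+
    then show ?thesis by simp
  qed auto
qed

section \<open>Arcs correspond to directed paths of the transitive reduction\<close>

definition reduced_paths :: "'v list set" where
  "reduced_paths = {p. dipath (transitive_reduction A) p \<and> (hd p, last p) \<in> A}"

lemma reduced_pathsD:
  assumes "p \<in> reduced_paths"
  shows "dipath (transitive_reduction A) p" "dipath A p" "(hd p, last p) \<in> A" "p \<noteq> []"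
  using assms dipath_mono[OF _ reduction_subset]
  by (auto simp: reduced_paths_def dipath_def)

text \<open>Suppose that the path misses a vertex \<open>t\<close> of the support. Let
  \<open>x\<close> be its last vertex with an arc to \<open>t\<close> and \<open>y\<close> the next
  one. The support is a clique, so there is an arc from \<open>t\<close> to \<open>y\<close>, and
  \<open>(x, y)\<close> is transitive although it belongs to the reduction.\<close>

lemma set_reduced_path:
  assumes "p \<in> reduced_paths"
  shows "set p = supp (hd p) (last p)"
proof
  note p = reduced_pathsD[OF assms]
  show "set p \<subseteq> supp (hd p) (last p)" using p by (auto simp: transitive_support_def)
  show "supp (hd p) (last p) \<subseteq> set p"
  proof (rule ccontr)
    assume "\<not> supp (hd p) (last p) \<subseteq> set p"
    then obtain t where t: "t \<in> supp (hd p) (last p)" "t \<notin> set p" by blast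
    then have ht: "(hd p, t) \<in> A" "(t, last p) \<in> A" using p supp_eq by auto
    then obtain ys x zs where x: "p = ys @ x # zs" "(x, t) \<in> A" "\<forall>z\<in>set zs. (z, t) \<notin> A"
      using split_list_last_prop[of p "\<lambda>x. (x, t) \<in> A"] p(4) hd_in_set by blast
    have "zs \<noteq> []" using x ht arc_antisym by (auto)
    then obtain y zs' where y: "zs = y # zs'" by (cases zs) auto
    have "(y, t) \<notin> A" "y \<noteq> t" "y \<in> set p"
      using x y t by auto
    moreover from this p(2) have "y \<in> supp (hd p) (last p)"
      unfolding transitive_support_def by blast
    ultimately have "(t, y) \<in> A" using supp_clique[OF p(3) _ t(1)] by blast
    moreover have "(x, y) \<in> transitive_reduction A"
      using dipath_middle_arc[of _ ys x y zs'] p(1) x y by simp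
    ultimately show False
      using not_in_reduction[of x y] x(2) reduction_subset by blast
  qed
qed

lemma sorted_reduced_path:
  assumes "p \<in> reduced_paths"
  shows "sorted_wrt (\<lambda>x y. (x, y) \<in> A) p"
  unfolding sorted_wrt_iff_nth_less
  using filledD[OF reduced_pathsD(2,3)[OF assms]] by blast

text \<open>The arc relation need not be transitive; antisymmetry suffices, since two different
  heads would each need an arc to the other.\<close>

lemma sorted_arcs_unique:
  assumes "sorted_wrt (\<lambda>x y. (x, y) \<in> A) p" "sorted_wrt (\<lambda>x y. (x, y) \<in> A) q" "set p = set q"
  shows "p = q"
  using assms
proof (induction p arbitrary: q)
  case (Cons x p)
  then obtain y q' where q: "q = y # q'" by (cases q) auto
  have "x = y"
  proof (rule ccontr)
    assume "x \<noteq> y"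
    then have "x \<in> set q'" "y \<in> set p" using Cons.prems(3) q by auto
    then show False using Cons.prems q arc_antisym by auto
  qed
  moreover have "x \<notin> set p" "y \<notin> set q'" using Cons.prems arc_irrefl q by auto
  ultimately have "set p = set q'" using Cons.prems(3) q by (simp add: insert_ident)
  then have "p = q'" using Cons.IH[of q'] Cons.prems q by simp
  with \<open>x = y\<close> show ?case using q by simp
qed simp

text \<open>Injectivity: the ends determine the support, which is the vertex set of the path, and
  arcs sort a set in at most one way.\<close>

lemma bij_betw_reduced_paths: "bij_betw (\<lambda>p. (hd p, last p)) reduced_paths A"
proof (rule bij_betwI')
  fix p q assume pq: "p \<in> reduced_paths" "q \<in> reduced_paths"
  show "(hd p, last p) = (hd q, last q) \<longleftrightarrow> p = q"
    using set_reduced_path pq sorted_reduced_path sorted_arcs_unique by (metis prod.inject)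
next
  fix a assume "a \<in> A"
  then obtain u w where a: "a = (u, w)" "(u, w) \<in> A" by (cases a) auto
  then obtain p where "dipath (transitive_reduction A) p" "hd p = u" "last p = w"
    using ex_dipath_if_rtrancl[OF trancl_into_rtrancl[OF arc_in_reduction_trancl]] by blast
  then show "\<exists>p\<in>reduced_paths. a = (hd p, last p)" using a by (auto simp: reduced_paths_def)
qed (auto simp: reduced_paths_def)

lemma ex_reduced_path:
  assumes "(u, w) \<in> A"
  obtains p where "p \<in> reduced_paths" "hd p = u" "last p = w"
proof -
  have "(u, w) \<in> (\<lambda>p. (hd p, last p)) ` reduced_paths"
    using bij_betw_reduced_paths assms by (simp add: bij_betw_def)
  then show ?thesis using that by auto
qed

lemma supp_connected:
  assumes "(u, w) \<in> A"
  shows "connected_in (transitive_reduction A) (supp u w)"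
proof -
  obtain p where p: "p \<in> reduced_paths" "hd p = u" "last p = w"
    using ex_reduced_path[OF assms] .
  show ?thesis
    using connected_in_set_dipath[OF reduced_pathsD(1)[OF p(1)]] set_reduced_path[OF p(1)] p by simp
qed

text \<open>If the reduced path from \<open>u\<close> to \<open>w\<close> left \<open>U\<close>, its
  excursion could be closed up by a path inside \<open>U\<close>, giving a cycle in the transitive
  reduction, which is a forest.\<close>

lemma supp_subset_if_connected:
  assumes "connected_in (transitive_reduction A) U" "(u, w) \<in> A" "u \<in> U" "w \<in> U"
  shows "supp u w \<subseteq> U"
proof (rule ccontr)
  let ?T = "transitive_reduction A"
  assume "\<not> supp u w \<subseteq> U"
  moreover obtain p where p: "p \<in> reduced_paths" "hd p = u" "last p = w"
    using ex_reduced_path[OF assms(2)] .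
  ultimately have "\<not> set p \<subseteq> U" using set_reduced_path[OF p(1)] by simp
  then obtain t where t: "t \<in> set p" "t \<notin> U" by blast
  then obtain xs ys where xy: "p = xs @ t # ys" by (meson split_list)
  have "xs \<noteq> []" "ys \<noteq> []" using xy p t assms by auto
  have "u \<in> set xs" "w \<in> set ys"
    using p(2,3) xy \<open>xs \<noteq> []\<close> \<open>ys \<noteq> []\<close> by auto
  \<comment> \<open>The excursion around \<open>t\<close> runs from the last vertex \<open>a\<close>
    of \<open>U\<close> before \<open>t\<close> to the first vertex \<open>b\<close> of
    \<open>U\<close> after it, so its inner part \<open>m\<close> avoids \<open>U\<close>.\<close>
  obtain xs' a g where a: "xs = xs' @ a # g" "a \<in> U" "\<forall>z\<in>set g. z \<notin> U"
    using split_list_last_prop[of xs "\<lambda>z. z \<in> U"] \<open>u \<in> set xs\<close> assms by blast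
  obtain ys' b h where b: "ys = h @ b # ys'" "b \<in> U" "\<forall>z\<in>set h. z \<notin> U"
    using split_list_first_prop[of ys "\<lambda>z. z \<in> U"] \<open>w \<in> set ys\<close> assms by blast
  note dp = reduced_pathsD(1)[OF p(1)]
  define m where "m = g @ t # h"
  have p_eq: "p = xs' @ a # m @ b # ys'" unfolding m_def xy a b by simp
  have m: "m \<noteq> []" "set m \<inter> U = {}" using a b t by (auto simp: m_def)
  have "dipath ?T (a # m @ b # ys')" using dp dipath_append(2) p_eq by blast
  then have am: "(a, hd m) \<in> ?T" "dipath ?T m" "(last m, b) \<in> ?T" "a \<noteq> b"
    using m by (auto simp: dipath_def successively_Cons successively_append_iff)
  have ba: "(b, a) \<in> (underlying (induced ?T U))\<^sup>*"
    using assms(1) a b unfolding connected_in_def by blast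
  obtain q where q: "dipath (underlying (induced ?T U)) q" "hd q = b" "last q = a"
    using ex_dipath_if_rtrancl[OF ba] by blast
  have q_ne: "q \<noteq> []" "tl q \<noteq> []" using q am(4) by (cases q; auto simp: dipath_def)+
  have qU: "set q \<subseteq> U"
  proof
    fix x assume x: "x \<in> set q"
    show "x \<in> U"
    proof (cases "x = b")
      case False
      obtain q' where q': "q = b # q'" using q q_ne by (cases q) auto
      then have "(b, x) \<in> (underlying (induced ?T U))\<^sup>+"
        using dipath_imp_trancl[of _ b q' x] q(1) x False by auto
      then show ?thesis by (cases rule: tranclE) (auto simp: underlying_def induced_def)
    qed (use b in simp)
  qed
  have qT: "dipath (underlying ?T) q" and mT: "dipath (underlying ?T) m"
    using q(1) am(2) by (auto elim!: dipath_mono simp: underlying_def induced_def)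
  \<comment> \<open>Since \<open>m\<close> is disjoint from \<open>U\<close> and \<open>q\<close>
    lies in \<open>U\<close>, the concatenation has no repeated vertex; \<open>a \<noteq> b\<close>
    gives \<open>q\<close> at least two vertices, so the cycle has at least three.\<close>
  have "dipath (underlying ?T) (m @ q)"
    using qT mT m qU am(3) q(2) q_ne
    by (auto simp: dipath_def successively_append_iff underlying_def)
  moreover have "length (m @ q) \<ge> 3" using q_ne m(1) by (cases m; cases q; cases "tl q") auto
  moreover have "(last (m @ q), hd (m @ q)) \<in> underlying ?T"
    using q q_ne m(1) am(1) by (auto simp: underlying_def)
  moreover have "undirected_forest ?T"
    using skeletal unfolding skeletal_def vertebrate_def
    by (metis Int_UNIV_right UNIV_Times_UNIV induced_def)
  ultimately show False unfolding undirected_forest_def by blast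
qed

end

section \<open>Lattice congruences of finite lattices\<close>

context partial_order
begin

lemma finite_lower_cover:
  assumes fin: "finite (carrier L)" and x: "x \<in> carrier L" and y: "y \<in> carrier L" and "x \<sqsubset> y"
  shows "\<exists>c. covered_by L c y \<and> x \<sqsubseteq> c"
  using x \<open>x \<sqsubset> y\<close>
proof (induction "card {z \<in> carrier L. x \<sqsubseteq> z}" arbitrary: x rule: less_induct)
  case less
  show ?case
  proof (cases "covered_by L x y")
    case False
    then obtain z where z: "z \<in> carrier L" "x \<sqsubset> z" "z \<sqsubset> y"
      using less.prems y unfolding covered_by_def by blast
    have le: "x \<sqsubseteq> z" and ne: "z \<noteq> x" using z(2) by (auto simp: lless_eq)
    have "{w \<in> carrier L. z \<sqsubseteq> w} \<subseteq> {w \<in> carrier L. x \<sqsubseteq> w}"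
      using le less.prems z(1) le_trans by blast
    moreover have "x \<in> {w \<in> carrier L. x \<sqsubseteq> w}" "x \<notin> {w \<in> carrier L. z \<sqsubseteq> w}"
      using less.prems(1) z(1) le ne le_antisym by auto
    ultimately have "{w \<in> carrier L. z \<sqsubseteq> w} \<subset> {w \<in> carrier L. x \<sqsubseteq> w}" by blast
    then have "card {w \<in> carrier L. z \<sqsubseteq> w} < card {w \<in> carrier L. x \<sqsubseteq> w}"
      using fin by (auto intro!: psubset_card_mono)
    then obtain c where "covered_by L c y" "z \<sqsubseteq> c" using less.hyps z by blast
    moreover from this have "c \<in> carrier L" by (simp add: covered_by_def)
    ultimately show ?thesis using le le_trans less.prems(1) z(1) by blast
  qed (use less.prems in auto)
qed

lemma lower_coverI:
  assumes "covered_by L c J" "\<And>x. x \<in> carrier L \<Longrightarrow> x \<sqsubset> J \<Longrightarrow> x \<sqsubseteq> c"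
  shows "join_irreducible L J" "lower_cover L J = c"
proof -
  have c: "c \<in> carrier L" "J \<in> carrier L" "c \<sqsubset> J"
    using assms(1) by (auto simp: covered_by_def)
  have "x = c" if "covered_by L x J" for x
    using that assms(2)[of x] c unfolding covered_by_def lless_eq by blast
  then have "\<exists>!x. covered_by L x J" "(THE x. covered_by L x J) = c"
    using assms(1) by blast+
  then show "join_irreducible L J" "lower_cover L J = c"
    using c by (auto simp: join_irreducible_def lower_cover_def)
qed

lemma lower_cover_properties:
  assumes "finite (carrier L)" "join_irreducible L J"
  shows "covered_by L (lower_cover L J) J"
    and "\<And>x. x \<in> carrier L \<Longrightarrow> x \<sqsubset> J \<Longrightarrow> x \<sqsubseteq> lower_cover L J"
proof -
  have 1: "J \<in> carrier L" "\<exists>!x. covered_by L x J"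
    using assms(2) by (auto simp: join_irreducible_def)
  show 2: "covered_by L (lower_cover L J) J"
    unfolding lower_cover_def using theI'[OF 1(2)] .
  show "x \<sqsubseteq> lower_cover L J" if "x \<in> carrier L" "x \<sqsubset> J" for x
    using finite_lower_cover[OF assms(1) that(1) 1(1) that(2)] 1(2) 2 by blast
qed

end

context lattice
begin

text \<open>It suffices to relate the ends of the interval from \<open>a = x \<sqinter> y\<close> to
  \<open>b = x \<squnion> y\<close>. By induction on the down-set of
  \<open>z \<sqsubseteq> b\<close>, joining \<open>z\<close> to \<open>a\<close> does not leave the
  \<open>s\<close>-class of \<open>a\<close>: a reducible \<open>z\<close> is the join of two
  smaller elements, and an irreducible \<open>z\<close> not below \<open>a\<close> is contracted by
  \<open>r\<close>, hence by \<open>s\<close>.\<close>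

lemma congruence_subset:
  assumes fin: "finite (carrier L)"
    and r: "lattice_congruence L r" and s: "lattice_congruence L s"
    and contr: "\<And>J. join_irreducible L J \<Longrightarrow> contracts L r J \<Longrightarrow> contracts L s J"
  shows "r \<subseteq> s"
proof
  have r_eq: "equiv (carrier L) r" and s_eq: "equiv (carrier L) s"
    using r s by (auto simp: lattice_congruence_def)
  have r_refl: "(x, x) \<in> r" and s_refl: "(x, x) \<in> s" if "x \<in> carrier L" for x
    using that r_eq s_eq by (auto simp: equiv_def refl_on_def)
  have r_sym: "(y, x) \<in> r" if "(x, y) \<in> r" for x y
    using that r_eq by (auto simp: equiv_def sym_def)
  have r_trans: "(x, z) \<in> r" if "(x, y) \<in> r" "(y, z) \<in> r" for x y z
    using that r_eq unfolding equiv_def trans_def by blast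
  have s_sym: "(y, x) \<in> s" if "(x, y) \<in> s" for x y
    using that s_eq by (auto simp: equiv_def sym_def)
  have s_trans: "(x, z) \<in> s" if "(x, y) \<in> s" "(y, z) \<in> s" for x y z
    using that s_eq unfolding equiv_def trans_def by blast
  have r_join: "(x \<squnion> y, x' \<squnion> y') \<in> r" and r_meet: "(x \<sqinter> y, x' \<sqinter> y') \<in> r"
    if "(x, x') \<in> r" "(y, y') \<in> r" for x x' y y'
    using that r by (auto simp: lattice_congruence_def)
  have s_join: "(x \<squnion> y, x' \<squnion> y') \<in> s" and s_meet: "(x \<sqinter> y, x' \<sqinter> y') \<in> s"
    if "(x, x') \<in> s" "(y, y') \<in> s" for x x' y y'
    using that s by (auto simp: lattice_congruence_def)
  fix p assume "p \<in> r"
  then obtain x y where p: "p = (x, y)" "(x, y) \<in> r" by (cases p) auto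
  then have xy: "x \<in> carrier L" "y \<in> carrier L" using r_eq by (auto simp: equiv_def)
  define a where "a = x \<sqinter> y"
  define b where "b = x \<squnion> y"
  have ab: "a \<in> carrier L" "b \<in> carrier L" using xy by (auto simp: a_def b_def)
  have meet_absorb: "u \<sqinter> v = u" "v \<sqinter> u = u" and join_absorb: "u \<squnion> v = v" "v \<squnion> u = v"
    if "u \<in> carrier L" "v \<in> carrier L" "u \<sqsubseteq> v" for u v
    using that by (auto intro!: le_antisym meet_le join_le join_left join_right meet_left meet_right)
  have "(a, y) \<in> r" "(b, y) \<in> r"
    using r_meet[OF p(2) r_refl[OF xy(2)]] r_join[OF p(2) r_refl[OF xy(2)]] meet_absorb[of y y]
      join_absorb[of y y] xy by (auto simp: a_def b_def)
  then have rab: "(a, b) \<in> r" using r_sym r_trans by blast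
  have key: "(a \<squnion> z, a) \<in> s" if "z \<in> carrier L" "z \<sqsubseteq> b" for z
    using that
  proof (induction "card {w \<in> carrier L. w \<sqsubseteq> z}" arbitrary: z rule: less_induct)
    case less
    note z = less.prems
    have smaller: "(a \<squnion> w, a) \<in> s" if w: "w \<in> carrier L" "w \<sqsubset> z" for w
    proof -
      have le: "w \<sqsubseteq> z" and ne: "w \<noteq> z" using w(2) by (auto simp: lless_eq)
      have "{v \<in> carrier L. v \<sqsubseteq> w} \<subseteq> {v \<in> carrier L. v \<sqsubseteq> z}"
        using le w(1) z(1) le_trans by blast
      moreover have "z \<in> {v \<in> carrier L. v \<sqsubseteq> z}" "z \<notin> {v \<in> carrier L. v \<sqsubseteq> w}"
        using w(1) z(1) le ne le_antisym by auto
      ultimately have "{v \<in> carrier L. v \<sqsubseteq> w} \<subset> {v \<in> carrier L. v \<sqsubseteq> z}" by blast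
      then have "card {v \<in> carrier L. v \<sqsubseteq> w} < card {v \<in> carrier L. v \<sqsubseteq> z}"
        using fin by (auto intro!: psubset_card_mono)
      moreover have "w \<sqsubseteq> b" using le z w(1) ab(2) le_trans by blast
      ultimately show ?thesis using less.hyps w(1) by blast
    qed
    show ?case
    proof (cases "z \<sqsubseteq> a")
      case True
      then show ?thesis using join_absorb z ab s_refl by metis
    next
      case False
      have az: "a \<sqinter> z \<in> carrier L" "a \<sqinter> z \<sqsubset> z"
        using False z ab meet_left[OF ab(1) z(1)] meet_right[OF ab(1) z(1)] by (auto simp: lless_eq)
      obtain c where c: "covered_by L c z" using finite_lower_cover[OF fin az(1) z(1) az(2)] by blast
      then have c': "c \<in> carrier L" "c \<sqsubset> z" "c \<sqsubseteq> z" by (auto simp: covered_by_def lless_eq)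
      show ?thesis
      proof (cases "join_irreducible L z")
        case True
        let ?c = "lower_cover L z"
        note lc = lower_cover_properties[OF fin True]
        have lc': "?c \<in> carrier L" "?c \<sqsubset> z" "?c \<sqsubseteq> z"
          using lc(1) by (auto simp: covered_by_def lless_eq)
        \<comment> \<open>Meeting \<open>a\<close> and \<open>b\<close> with \<open>z\<close> gives
          this pair. As \<open>a \<sqinter> z\<close> is strictly below \<open>z\<close>, it lies
          below the lower cover, and joining the pair with that cover shows that \<open>r\<close>
          contracts \<open>z\<close>.\<close>
        have "(a \<sqinter> z, z) \<in> r"
          using r_meet[OF rab r_refl[OF z(1)]] meet_absorb[OF z(1) ab(2) z(2)] by simp
        then have "(?c, z) \<in> r"
          using r_join[OF r_refl[OF lc'(1)], of "a \<sqinter> z" z] lc(2)[OF az] lc' az z join_absorb by metis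
        then have "(?c, z) \<in> s" using contr[OF True] by (simp add: contracts_def)
        then have "(a \<squnion> z, a \<squnion> ?c) \<in> s" using s_join[OF s_refl[OF ab(1)]] s_sym by blast
        then show ?thesis using smaller[OF lc'(1,2)] s_trans by blast
      next
        case False
        \<comment> \<open>Not being below \<open>a\<close>, the element \<open>z\<close> has a lower
          cover \<open>c\<close>; reducibility means that there is a second one, and two distinct
          lower covers of \<open>z\<close> join to \<open>z\<close>.\<close>
        then obtain d where d: "covered_by L d z" "d \<noteq> c"
          using c z unfolding join_irreducible_def by blast
        then have d': "d \<in> carrier L" "d \<sqsubset> z" "d \<sqsubseteq> z" by (auto simp: covered_by_def lless_eq)
        have cd: "c \<squnion> d = z"
        proof (rule ccontr)
          assume "c \<squnion> d \<noteq> z"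
          moreover have "c \<squnion> d \<sqsubseteq> z" using c' d' z join_le by blast
          ultimately have "c \<squnion> d \<sqsubset> z" by (simp add: lless_eq)
          then have "\<not> c \<sqsubset> c \<squnion> d" "\<not> d \<sqsubset> c \<squnion> d"
            using c d(1) c' d' join_closed unfolding covered_by_def by blast+
          then have "c = c \<squnion> d" "d = c \<squnion> d"
            using join_left[OF c'(1) d'(1)] join_right[OF c'(1) d'(1)] by (auto simp: lless_eq)
          then show False using d(2) by simp
        qed
        moreover have "(a \<squnion> c) \<squnion> (a \<squnion> d) = a \<squnion> z"
        proof (rule le_antisym)
          let ?u = "(a \<squnion> c) \<squnion> (a \<squnion> d)"
          have car: "a \<squnion> c \<in> carrier L" "a \<squnion> d \<in> carrier L" "a \<squnion> z \<in> carrier L" "?u \<in> carrier L"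
            using ab c' d' z by auto
          have mono: "a \<squnion> w \<sqsubseteq> a \<squnion> z" if "w \<in> carrier L" "w \<sqsubseteq> z" for w
            using that ab z car(3) join_left[OF ab(1) z(1)] le_trans[OF that(2) join_right[OF ab(1) z(1)]]
            by (intro join_le) auto
          show "?u \<sqsubseteq> a \<squnion> z" using mono c' d' car by (rule_tac join_le) auto
          note u = join_left[OF car(1,2)] join_right[OF car(1,2)]
          have "a \<sqsubseteq> ?u" "c \<sqsubseteq> ?u" "d \<sqsubseteq> ?u"
            using le_trans[OF join_left[OF ab(1) c'(1)] u(1)] le_trans[OF join_right[OF ab(1) c'(1)] u(1)]
              le_trans[OF join_right[OF ab(1) d'(1)] u(2)] ab c' d' car by auto
          then show "a \<squnion> z \<sqsubseteq> ?u"
            using cd join_le[of c ?u d] ab c' d' z car by (rule_tac join_le) auto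
        qed (use ab c' d' z in auto)
        moreover have "((a \<squnion> c) \<squnion> (a \<squnion> d), a \<squnion> a) \<in> s"
          using s_join smaller c' d' by blast
        ultimately show ?thesis using join_absorb(1)[of a a] ab by simp
      qed
    qed
  qed
  have "a \<sqsubseteq> x" "a \<sqsubseteq> y" "x \<sqsubseteq> b" "y \<sqsubseteq> b"
    using xy by (auto simp: a_def b_def meet_left meet_right join_left join_right)
  have le: "a \<sqsubseteq> b" using \<open>a \<sqsubseteq> x\<close> \<open>x \<sqsubseteq> b\<close> ab xy le_trans by blast
  then have "(b, a) \<in> s" using key[of b] ab join_absorb by auto
  then have "(x \<sqinter> b, x \<sqinter> a) \<in> s" "(y \<sqinter> b, y \<sqinter> a) \<in> s"
    using s_meet s_refl xy by blast+
  then have "(x, a) \<in> s" "(y, a) \<in> s"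
    using meet_absorb xy ab \<open>a \<sqsubseteq> x\<close> \<open>a \<sqsubseteq> y\<close> \<open>x \<sqsubseteq> b\<close> \<open>y \<sqsubseteq> b\<close> by auto
  then show "p \<in> s" using p s_sym s_trans by blast
qed

lemma congruence_unique:
  assumes "finite (carrier L)" "lattice_congruence L r" "lattice_congruence L s"
    and "{J. join_irreducible L J \<and> \<not> contracts L r J} =
         {J. join_irreducible L J \<and> \<not> contracts L s J}"
  shows "r = s"
  using congruence_subset[OF assms(1-3)] congruence_subset[OF assms(1,3,2)] assms(4) by blast

end

section \<open>The lattice of acyclic reorientations\<close>

text \<open>The future join of two reorientations is the closure of their union. The usual
  transitive closure would leave the graph, so a composite is added only when it is an arc of
  \<open>A\<close>.\<close>

inductive_set arc_closure :: "'v digraph \<Rightarrow> 'v digraph \<Rightarrow> 'v digraph"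
  for A X where
  base: "a \<in> X \<Longrightarrow> a \<in> arc_closure A X"
| step: "(u, v) \<in> arc_closure A X \<Longrightarrow> (v, w) \<in> arc_closure A X \<Longrightarrow> (u, w) \<in> A \<Longrightarrow>
    (u, w) \<in> arc_closure A X"

context skeletal_dag
begin

text \<open>Separated from \<open>biclosed\<close> because this half is preserved by unions, whereas
  closedness under composition is restored by \<open>arc_closure\<close>.\<close>

definition coclosed :: "'v digraph \<Rightarrow> bool" where
  "coclosed R \<longleftrightarrow>
     (\<forall>u v w. (u, v) \<in> A \<longrightarrow> (v, w) \<in> A \<longrightarrow> (u, w) \<in> R \<longrightarrow> (u, v) \<in> R \<or> (v, w) \<in> R)"

text \<open>The two conditions forbid the two ways in which a triangle of \<open>A\<close> can be
  reoriented into a directed cycle. For a transitive tournament these sets are the inversion sets of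
  permutations.\<close>

definition biclosed :: "'v digraph \<Rightarrow> bool" where
  "biclosed R \<longleftrightarrow> R \<subseteq> A \<and> coclosed R \<and>
     (\<forall>u v w. (u, v) \<in> R \<longrightarrow> (v, w) \<in> R \<longrightarrow> (u, w) \<in> A \<longrightarrow> (u, w) \<in> R)"

lemma biclosedD:
  assumes "biclosed R"
  shows "R \<subseteq> A"
    and "\<And>u v w. (u, v) \<in> R \<Longrightarrow> (v, w) \<in> R \<Longrightarrow> (u, w) \<in> A \<Longrightarrow> (u, w) \<in> R"
    and "\<And>u v w. (u, v) \<in> A \<Longrightarrow> (v, w) \<in> A \<Longrightarrow> (u, w) \<in> R \<Longrightarrow> (u, v) \<in> R \<or> (v, w) \<in> R"
  using assms unfolding biclosed_def coclosed_def by blast+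

lemma mem_reorient: "(u, v) \<in> reorient A R \<longleftrightarrow> (u, v) \<in> A \<and> (u, v) \<notin> R \<or> (v, u) \<in> R"
  by (auto simp: reorient_def)

text \<open>The underlying graph is chordal: a shortest directed cycle of a reorientation is
  chordless, hence a triangle.\<close>

lemma acyclic_reorient_biclosed:
  assumes R: "biclosed R"
  shows "acyclic (reorient A R)"
proof (rule ccontr)
  let ?E = "reorient A R"
  let ?cyc = "\<lambda>p. dipath ?E p \<and> (last p, hd p) \<in> ?E"
  assume "\<not> acyclic ?E"
  then obtain x where "(x, x) \<in> ?E\<^sup>+" by (auto simp: acyclic_def)
  then obtain y where y: "(x, y) \<in> ?E" "(y, x) \<in> ?E\<^sup>*" using tranclD by metis
  obtain p0 where "?cyc p0" using ex_dipath_if_rtrancl[OF y(2)] y(1) by auto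
  then obtain p where p: "?cyc p" and minimal: "\<And>q. ?cyc q \<Longrightarrow> length p \<le> length q"
    using ex_has_least_nat[of ?cyc p0 length] by blast
  define n where "n = length p"
  have RA: "R \<subseteq> A" using biclosedD(1)[OF R] .
  have dp: "p \<noteq> []" "distinct p" "successively (\<lambda>u v. (u, v) \<in> ?E) p"
    using p by (auto simp: dipath_def)
  have ends: "hd p = p ! 0" "last p = p ! (n - 1)"
    using dp(1) by (auto simp: n_def hd_conv_nth last_conv_nth)
  have und: "(x, y) \<in> ?E \<or> (y, x) \<in> ?E \<longleftrightarrow> (x, y) \<in> underlying A" for x y
    using RA by (auto simp: mem_reorient underlying_def)
  have succE: "(p ! i, p ! Suc i) \<in> ?E" if "Suc i < n" for i
    using dp(3) that by (auto simp: n_def successively_conv_nth)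
  \<comment> \<open>A chord pointing forward along the cycle shortcuts it, and a chord pointing
    backward closes a segment into a cycle; minimality leaves only the edges of the cycle.\<close>
  have chordless: "j = Suc i \<or> i = 0 \<and> j = n - 1"
    if ij: "i < j" "j < n" and adj: "(p ! i, p ! j) \<in> underlying A" for i j
  proof -
    consider "(p ! i, p ! j) \<in> ?E" | "(p ! j, p ! i) \<in> ?E" using adj und by blast
    then show ?thesis
    proof cases
      case 1
      let ?q = "take (Suc i) p @ drop j p"
      have last: "last (take (Suc i) p) = p ! i"
        using ij by (simp add: take_Suc_conv_app_nth n_def)
      have hd: "hd (drop j p) = p ! j" using ij by (simp add: hd_drop_conv_nth n_def)
      have "successively (\<lambda>u v. (u, v) \<in> ?E) (take (Suc i) p)"
        "successively (\<lambda>u v. (u, v) \<in> ?E) (drop j p)"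
        using dp(3) append_take_drop_id[of "Suc i" p] append_take_drop_id[of j p]
          successively_append_iff by metis+
      moreover have "distinct ?q"
        using dp(2) ij by (auto simp: set_take_disj_set_drop_if_distinct)
      ultimately have "dipath ?E ?q"
        using 1 last hd ij by (auto simp: dipath_def successively_append_iff n_def)
      moreover have "hd ?q = hd p" "last ?q = last p"
        using ij dp(1) by (auto simp: n_def)
      ultimately have "length p \<le> length ?q" using p minimal by metis
      then have "j = Suc i" using ij by (simp add: n_def)
      then show ?thesis by simp
    next
      case 2
      let ?q = "drop i (take (Suc j) p)"
      have "successively (\<lambda>u v. (u, v) \<in> ?E) ?q"
        using dp(3) append_take_drop_id[of "Suc j" p] append_take_drop_id[of i "take (Suc j) p"]
          successively_append_iff by metis
      then have "dipath ?E ?q"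
        using ij dp(2) by (auto simp: dipath_def n_def)
      moreover have "hd ?q = p ! i" "last ?q = p ! j"
        using ij by (auto simp: n_def hd_drop_conv_nth take_Suc_conv_app_nth)
      ultimately have "length p \<le> length ?q" using 2 minimal by metis
      then show ?thesis using ij by (auto simp: n_def)
    qed
  qed
  have irrefl: "(x, x) \<notin> ?E" for x using arc_irrefl RA by (auto simp: mem_reorient)
  have antisym: "(y, x) \<notin> ?E" if "(x, y) \<in> ?E" for x y
    using that arc_antisym RA unfolding mem_reorient by blast
  have "n \<noteq> 0" using dp(1) by (simp add: n_def)
  moreover have "n \<noteq> 1" using p irrefl ends by auto
  moreover have "n \<noteq> 2" using p antisym[OF succE[of 0]] ends by (auto simp: numeral_2_eq_2)
  moreover have "n \<noteq> 3"
  proof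
    assume n: "n = 3"
    then have "(p ! 0, p ! 1) \<in> ?E" "(p ! 1, p ! 2) \<in> ?E" "(p ! 2, p ! 0) \<in> ?E"
      using succE[of 0] succE[of 1] p ends by (auto simp: numeral_2_eq_2)
    then show False
      using biclosedD[OF R] no_triangle unfolding mem_reorient by blast
  qed
  ultimately have n4: "n \<ge> 4" by linarith
  let ?I = "induced A (set p)"
  have no_clique: False
    if ijk: "i < j" "j < k" "k < n" "(p ! i, p ! j) \<in> underlying A" "(p ! j, p ! k) \<in> underlying A"
      "(p ! i, p ! k) \<in> underlying A" for i j k
    using chordless[of i j] chordless[of j k] chordless[of i k] ijk n4 by linarith
  \<comment> \<open>Filledness would turn such a path into three pairwise adjacent vertices of the
    cycle, impossible in a chordless cycle of length at least four.\<close>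
  have no_path3: "\<not> (dipath ?I q \<and> length q \<ge> 3 \<and> (hd q, last q) \<in> A)" for q
  proof
    assume q: "dipath ?I q \<and> length q \<ge> 3 \<and> (hd q, last q) \<in> A"
    then have "dipath A q" by (auto elim!: dipath_mono simp: induced_def)
    then have arcs: "(q ! 0, q ! 1) \<in> A" "(q ! 1, q ! 2) \<in> A" "(q ! 0, q ! 2) \<in> A"
      using filledD[of q] q by auto
    have "(q ! 0, q ! 1) \<in> ?I" "(q ! 1, q ! 2) \<in> ?I"
      using q by (auto simp: dipath_def successively_conv_nth numeral_2_eq_2)
    then obtain a b c where abc: "a < n" "b < n" "c < n" "q ! 0 = p ! a" "q ! 1 = p ! b" "q ! 2 = p ! c"
      by (auto simp: induced_def in_set_conv_nth n_def)
    have und3: "(p ! a, p ! b) \<in> underlying A" "(p ! b, p ! c) \<in> underlying A" "(p ! a, p ! c) \<in> underlying A"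
      "(p ! b, p ! a) \<in> underlying A" "(p ! c, p ! b) \<in> underlying A" "(p ! c, p ! a) \<in> underlying A"
      using arcs abc by (auto simp: underlying_def)
    have "a \<noteq> b" "b \<noteq> c" "a \<noteq> c" using arcs abc arc_irrefl by metis+
    then consider "a < b" "b < c" | "a < c" "c < b" | "b < a" "a < c" | "b < c" "c < a"
      | "c < a" "a < b" | "c < b" "b < a" by linarith
    then show False by cases (use no_clique und3 abc in blast)+
  qed
  \<comment> \<open>Thus the subgraph induced on the cycle is its own transitive reduction, and that
    reduction contains the cycle, against vertebrateness.\<close>
  have "?I \<subseteq> transitive_reduction ?I"
    using no_path3 by (fastforce simp: transitive_reduction_def induced_def)
  moreover have "successively (\<lambda>u v. (u, v) \<in> underlying ?I) p" "(last p, hd p) \<in> underlying ?I"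
  proof -
    have *: "(x, y) \<in> underlying ?I" if "(x, y) \<in> ?E" "x \<in> set p" "y \<in> set p" for x y
      using that und[of x y] by (auto simp: underlying_def induced_def)
    show "(last p, hd p) \<in> underlying ?I" using p dp(1) * by auto
    show "successively (\<lambda>u v. (u, v) \<in> underlying ?I) p"
      unfolding successively_conv_nth using succE * by (auto simp: n_def)
  qed
  ultimately have "dipath (underlying (transitive_reduction ?I)) p"
      "(last p, hd p) \<in> underlying (transitive_reduction ?I)"
    using dp by (auto simp: dipath_def underlying_def elim!: successively_mono)
  moreover have "undirected_forest (transitive_reduction ?I)"
    using skeletal unfolding skeletal_def vertebrate_def by blast
  moreover have "length p \<ge> 3" using n4 n_def by simp
  ultimately show False unfolding undirected_forest_def by blast
qed

text \<open>For the remaining direction, a violation of either condition is a directed triangle of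
  the reorientation.\<close>

lemma acyclic_reorientations_eq: "acyclic_reorientations A = {R. biclosed R}"
proof -
  have "biclosed R" if R: "R \<subseteq> A" "acyclic (reorient A R)" for R
  proof -
    have no3: "\<not> ((x, y) \<in> reorient A R \<and> (y, z) \<in> reorient A R \<and> (z, x) \<in> reorient A R)" for x y z
      using R(2) by (meson acyclic_def trancl.intros)
    show ?thesis
      unfolding biclosed_def coclosed_def
    proof (intro conjI allI impI)
      fix u v w
      assume "(u, v) \<in> R" "(v, w) \<in> R" "(u, w) \<in> A"
      then show "(u, w) \<in> R" using no3[of u w v] by (auto simp: mem_reorient)
    next
      fix u v w
      assume "(u, v) \<in> A" "(v, w) \<in> A" "(u, w) \<in> R"
      then show "(u, v) \<in> R \<or> (v, w) \<in> R" using no3[of u v w] by (auto simp: mem_reorient)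
    qed fact
  qed
  then show ?thesis
    using acyclic_reorient_biclosed biclosedD(1) by (auto simp: acyclic_reorientations_def)
qed

lemma biclosed_complement: "biclosed R \<Longrightarrow> biclosed (A - R)"
  unfolding biclosed_def coclosed_def by blast

text \<open>Only coclosedness is at stake. When \<open>(u, w)\<close> arises through
  \<open>v\<close>, any other intermediate \<open>t\<close> is comparable with \<open>v\<close> by
  \<open>diamond\<close>; the induction hypothesis applies to the half containing \<open>t\<close>,
  and one more composition with the other half finishes.\<close>

lemma arc_closure_biclosed:
  assumes "X \<subseteq> A" "coclosed X"
  shows "biclosed (arc_closure A X)"
proof -
  have sub: "arc_closure A X \<subseteq> A"
  proof
    fix a assume "a \<in> arc_closure A X"
    then show "a \<in> A" by cases (use assms in auto)
  qed
  have "\<forall>t. (fst a, t) \<in> A \<longrightarrow> (t, snd a) \<in> A \<longrightarrow>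
      (fst a, t) \<in> arc_closure A X \<or> (t, snd a) \<in> arc_closure A X" if "a \<in> arc_closure A X" for a
    using that
  proof (induction rule: arc_closure.induct)
    case (base a)
    then show ?case
      using assms(2) arc_closure.base unfolding coclosed_def by (metis prod.collapse)
  next
    case (step u v w)
    note uv = subsetD[OF sub step(1)] and vw = subsetD[OF sub step(2)]
    have "(u, t) \<in> arc_closure A X \<or> (t, w) \<in> arc_closure A X" if t: "(u, t) \<in> A" "(t, w) \<in> A" for t
    proof -
      consider "t = v" | "(v, t) \<in> A" | "(t, v) \<in> A" using diamond[OF uv vw t] by blast
      then show ?thesis
      proof cases
        case 2
        then have "(v, t) \<in> arc_closure A X \<or> (t, w) \<in> arc_closure A X"
          using step.IH(2) t by simp
        then show ?thesis using arc_closure.step[OF step(1) _ t(1)] by blast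
      next
        case 3
        then have "(u, t) \<in> arc_closure A X \<or> (t, v) \<in> arc_closure A X"
          using step.IH(1) t by simp
        then show ?thesis using arc_closure.step[OF _ step(2) t(2)] by blast
      qed (use step in auto)
    qed
    then show ?case by simp
  qed
  then have "coclosed (arc_closure A X)" unfolding coclosed_def by (metis fst_conv snd_conv)
  then show ?thesis
    unfolding biclosed_def using sub arc_closure.step[of _ _ A X] by blast
qed

lemma arc_closure_least:
  assumes "X \<subseteq> R" "biclosed R"
  shows "arc_closure A X \<subseteq> R"
proof
  fix a assume "a \<in> arc_closure A X"
  then show "a \<in> R" by induction (use assms biclosedD(2) in blast)+
qed

lemma biclosed_Un:
  assumes "biclosed R" "biclosed S"
  shows "biclosed (arc_closure A (R \<union> S))"
proof (rule arc_closure_biclosed)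
  show "R \<union> S \<subseteq> A" using assms biclosedD(1) by blast
  show "coclosed (R \<union> S)" using assms unfolding biclosed_def coclosed_def by blast
qed

lemma AR_simps [simp]:
  "carrier (AR A) = {R. biclosed R}" "R \<sqsubseteq>\<^bsub>AR A\<^esub> S \<longleftrightarrow> R \<subseteq> S" "R .=\<^bsub>AR A\<^esub> S \<longleftrightarrow> R = S"
  "R \<sqsubset>\<^bsub>AR A\<^esub> S \<longleftrightarrow> R \<subset> S"
  by (auto simp: AR_def acyclic_reorientations_eq lless_def)

lemma lattice_AR: "lattice (AR A)"
proof -
  interpret partial_order "AR A"
    by unfold_locales (auto simp: AR_def)
  show ?thesis
  proof
    fix R S assume "R \<in> carrier (AR A)" "S \<in> carrier (AR A)"
    then have RS: "biclosed R" "biclosed S" by auto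
    have "least (AR A) (arc_closure A (R \<union> S)) (Upper (AR A) {R, S})"
      using RS biclosed_Un[OF RS] arc_closure_least[of "R \<union> S"] arc_closure.base[of _ "R \<union> S" A]
      by (intro least_UpperI) (auto simp: Upper_def)
    then show "\<exists>s. least (AR A) s (Upper (AR A) {R, S})" by blast
    \<comment> \<open>Complementation in \<open>A\<close> preserves biclosed sets and reverses
      inclusion, so the meet is the complement of the join of the complements.\<close>
    let ?m = "A - arc_closure A ((A - R) \<union> (A - S))"
    have m: "biclosed ?m" using RS biclosed_Un biclosed_complement by blast
    have "T \<subseteq> ?m" if "biclosed T" "T \<subseteq> R" "T \<subseteq> S" for T
      using arc_closure_least[of "(A - R) \<union> (A - S)" "A - T"] biclosed_complement[OF that(1)] that
        biclosedD(1)[OF that(1)] by blast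
    moreover have "?m \<subseteq> R" "?m \<subseteq> S" using arc_closure.base[of _ "(A - R) \<union> (A - S)" A] by blast+
    ultimately have "greatest (AR A) ?m (Lower (AR A) {R, S})"
      using RS m by (intro greatest_LowerI) (auto simp: Lower_def)
    then show "\<exists>s. greatest (AR A) s (Lower (AR A) {R, S})" by blast
  qed
qed

end

section \<open>The sylvester congruence\<close>

context skeletal_dag
begin

text \<open>The conditions say that the sink of the support of \<open>(u, w)\<close> is \<open>u\<close>, respectively \<open>w\<close>.\<close>

definition first_sinks :: "'v digraph \<Rightarrow> 'v digraph" where
  "first_sinks R = {(u, w) \<in> A. \<forall>s\<in>supp u w - {u}. (u, s) \<in> R}"

definition last_sinks :: "'v digraph \<Rightarrow> 'v digraph" where
  "last_sinks R = {(u, w) \<in> A. \<forall>s\<in>supp u w - {w}. (s, w) \<notin> R}"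

definition is_sink :: "'v digraph \<Rightarrow> 'v \<Rightarrow> 'v \<Rightarrow> 'v \<Rightarrow> bool" where
  "is_sink R u w t \<longleftrightarrow> t \<in> supp u w \<and> (\<forall>s\<in>supp u w. (t, s) \<notin> reorient A R)"

lemma supp_first: "(u, w) \<in> A \<Longrightarrow> s \<in> supp u w \<Longrightarrow> s \<noteq> u \<Longrightarrow> (u, s) \<in> A"
  and supp_last: "(u, w) \<in> A \<Longrightarrow> s \<in> supp u w \<Longrightarrow> s \<noteq> w \<Longrightarrow> (s, w) \<in> A"
  by (auto simp: supp_eq)

text \<open>If \<open>u\<close> is not the sink, choose the \<open>A\<close>-minimal
  \<open>s\<close> with \<open>(u, s)\<close> not reversed. For \<open>t\<close> strictly between,
  \<open>(u, t)\<close> is reversed, so closedness of \<open>R\<close> keeps \<open>(t, s)\<close>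
  unreversed: \<open>s\<close> is the sink of the support of \<open>(u, s)\<close>.\<close>

lemma first_sinks_iff:
  assumes R: "biclosed R" and uw: "(u, w) \<in> A"
  shows "(u, w) \<in> first_sinks R \<longleftrightarrow> (\<forall>s\<in>supp u w - {u}. (u, s) \<notin> last_sinks R)"
proof
  assume "(u, w) \<in> first_sinks R"
  moreover have "u \<in> supp u s - {s}" if "(u, s) \<in> A" for s
    using supp_ends(1)[OF that] that arc_irrefl by auto
  ultimately show "\<forall>s\<in>supp u w - {u}. (u, s) \<notin> last_sinks R"
    by (auto simp: first_sinks_def last_sinks_def)
next
  assume no: "\<forall>s\<in>supp u w - {u}. (u, s) \<notin> last_sinks R"
  show "(u, w) \<in> first_sinks R"
  proof (rule ccontr)
    assume "(u, w) \<notin> first_sinks R"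
    then obtain s0 where "s0 \<in> {s \<in> supp u w - {u}. (u, s) \<notin> R}"
      using uw by (auto simp: first_sinks_def)
    from wfE_min[OF wf_arcs this] obtain s where s: "s \<in> {s \<in> supp u w - {u}. (u, s) \<notin> R}"
      and minimal: "\<And>t. (t, s) \<in> A \<Longrightarrow> t \<notin> {s \<in> supp u w - {u}. (u, s) \<notin> R}"
      by blast
    have us: "(u, s) \<in> A" using supp_first uw s by blast
    have "(t, s) \<notin> R" if t: "t \<in> supp u s - {s}" for t
    proof (cases "t = u")
      case False
      then have "(u, t) \<in> A" "(t, s) \<in> A" using t us by (auto simp: supp_eq)
      moreover have "t \<in> supp u w"
        using supp_convex[OF uw supp_ends(1)[OF uw] _ us] s t by blast
      ultimately have "(u, t) \<in> R" using minimal[of t] False by blast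
      then show ?thesis using biclosedD(2)[OF R _ _ us] s by blast
    qed (use s in blast)
    then have "(u, s) \<in> last_sinks R" using us by (auto simp: last_sinks_def)
    then show False using no s by blast
  qed
qed

text \<open>The mirror image of \<open>first_sinks_iff\<close>, with an \<open>A\<close>-maximal
  \<open>s\<close> and with coclosedness in place of closedness.\<close>

lemma last_sinks_iff:
  assumes R: "biclosed R" and uw: "(u, w) \<in> A"
  shows "(u, w) \<in> last_sinks R \<longleftrightarrow> (\<forall>s\<in>supp u w - {w}. (s, w) \<notin> first_sinks R)"
proof
  assume "(u, w) \<in> last_sinks R"
  moreover have "w \<in> supp s w - {s}" if "(s, w) \<in> A" for s
    using supp_ends(2)[OF that] that arc_irrefl by auto
  ultimately show "\<forall>s\<in>supp u w - {w}. (s, w) \<notin> first_sinks R"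
    by (auto simp: first_sinks_def last_sinks_def)
next
  assume no: "\<forall>s\<in>supp u w - {w}. (s, w) \<notin> first_sinks R"
  show "(u, w) \<in> last_sinks R"
  proof (rule ccontr)
    assume "(u, w) \<notin> last_sinks R"
    then obtain s0 where s0: "s0 \<in> {s \<in> supp u w - {w}. (s, w) \<in> R}"
      using uw by (auto simp: last_sinks_def)
    obtain s
      where s: "s \<in> {s \<in> supp u w - {w}. (s, w) \<in> R}"
      and minimal: "\<And>t. (t, s) \<in> A\<inverse> \<Longrightarrow> t \<notin> {s \<in> supp u w - {w}. (s, w) \<in> R}"
      by (rule wfE_min[OF wf_arcs_converse s0]) (rule that)
    have sw: "(s, w) \<in> A" using supp_last uw s by blast
    have "(s, t) \<in> R" if t: "t \<in> supp s w - {s}" for t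
    proof (cases "t = w")
      case False
      then have st: "(s, t) \<in> A" "(t, w) \<in> A" using t sw by (auto simp: supp_eq)
      moreover have "t \<in> supp u w"
        using supp_convex[OF uw _ supp_ends(2)[OF uw] sw] s t by blast
      ultimately have "(t, w) \<notin> R" using minimal[of t] False by simp
      then show ?thesis using biclosedD(3)[OF R st] s by blast
    qed (use s in blast)
    then have "(s, w) \<in> first_sinks R" using sw by (auto simp: first_sinks_def)
    then show False using no s by blast
  qed
qed

lemma sinks_subset: "first_sinks R \<subseteq> A" "last_sinks R \<subseteq> A"
  by (auto simp: first_sinks_def last_sinks_def)

lemma first_sinks_eq_iff_last_sinks_eq:
  assumes "biclosed R" "biclosed S"
  shows "first_sinks R = first_sinks S \<longleftrightarrow> last_sinks R = last_sinks S"
proof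
  assume "first_sinks R = first_sinks S"
  then have "(u, w) \<in> last_sinks R \<longleftrightarrow> (u, w) \<in> last_sinks S" if "(u, w) \<in> A" for u w
    using last_sinks_iff[OF assms(1) that] last_sinks_iff[OF assms(2) that] by simp
  then show "last_sinks R = last_sinks S" using sinks_subset(2) by auto
next
  assume "last_sinks R = last_sinks S"
  then have "(u, w) \<in> first_sinks R \<longleftrightarrow> (u, w) \<in> first_sinks S" if "(u, w) \<in> A" for u w
    using first_sinks_iff[OF assms(1) that] first_sinks_iff[OF assms(2) that] by simp
  then show "first_sinks R = first_sinks S" using sinks_subset(1) by auto
qed

text \<open>The vertices of the support after \<open>t\<close> form the support of
  \<open>(t, w)\<close> without \<open>t\<close>, those before it the support of
  \<open>(u, t)\<close> without \<open>t\<close>. Hence an arbitrary sink is determined by the two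
  extreme kinds.\<close>

lemma is_sink_iff:
  assumes R: "R \<subseteq> A" and uw: "(u, w) \<in> A"
  shows "is_sink R u w t \<longleftrightarrow> t \<in> supp u w \<and> (t = w \<or> (t, w) \<in> first_sinks R) \<and>
    (t = u \<or> (u, t) \<in> last_sinks R)"
proof (cases "t \<in> supp u w")
  case True
  have "(\<forall>s\<in>supp u w. (t, s) \<in> A \<longrightarrow> (t, s) \<in> R) \<longleftrightarrow> t = w \<or> (t, w) \<in> first_sinks R"
  proof (cases "t = w")
    case True
    then show ?thesis using uw arc_irrefl arc_antisym by (auto simp: supp_eq)
  next
    case False
    then have tw: "(t, w) \<in> A" using supp_last uw True by blast
    have "{s \<in> supp u w. (t, s) \<in> A} = supp t w - {t}"
    proof
      show "supp t w - {t} \<subseteq> {s \<in> supp u w. (t, s) \<in> A}"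
        using supp_convex[OF uw True supp_ends(2)[OF uw] tw] supp_first[OF tw] by blast
      show "{s \<in> supp u w. (t, s) \<in> A} \<subseteq> supp t w - {t}"
        using supp_last[OF uw] arc_irrefl by (auto simp: supp_eq[OF tw])
    qed
    then show ?thesis using tw False by (auto simp: first_sinks_def)
  qed
  moreover have "(\<forall>s\<in>supp u w. (s, t) \<in> A \<longrightarrow> (s, t) \<notin> R) \<longleftrightarrow> t = u \<or> (u, t) \<in> last_sinks R"
  proof (cases "t = u")
    case True
    then show ?thesis using uw arc_irrefl arc_antisym by (auto simp: supp_eq)
  next
    case False
    then have ut: "(u, t) \<in> A" using supp_first uw True by blast
    have "{s \<in> supp u w. (s, t) \<in> A} = supp u t - {t}"
    proof
      show "supp u t - {t} \<subseteq> {s \<in> supp u w. (s, t) \<in> A}"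
        using supp_convex[OF uw supp_ends(1)[OF uw] True ut] supp_last[OF ut] by blast
      show "{s \<in> supp u w. (s, t) \<in> A} \<subseteq> supp u t - {t}"
        using supp_first[OF uw] arc_irrefl by (auto simp: supp_eq[OF ut])
    qed
    then show ?thesis using ut False by (auto simp: last_sinks_def)
  qed
  moreover have "is_sink R u w t \<longleftrightarrow>
      (\<forall>s\<in>supp u w. (t, s) \<in> A \<longrightarrow> (t, s) \<in> R) \<and> (\<forall>s\<in>supp u w. (s, t) \<notin> R)"
    using True by (auto simp: is_sink_def mem_reorient)
  moreover have "(\<forall>s\<in>supp u w. (s, t) \<notin> R) \<longleftrightarrow> (\<forall>s\<in>supp u w. (s, t) \<in> A \<longrightarrow> (s, t) \<notin> R)"
    using R by blast
  ultimately show ?thesis using True by simp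
qed (simp add: is_sink_def)

lemma ex_is_sink:
  assumes R: "biclosed R" and uw: "(u, w) \<in> A"
  shows "\<exists>!t. is_sink R u w t"
proof (rule ex_ex1I)
  have wf: "wf ((reorient A R)\<inverse>)"
    using acyclic_reorient_biclosed[OF R] finite by (rule finite_acyclic_wf_converse[rotated])
  obtain t
    where t: "t \<in> supp u w" "\<And>s. (s, t) \<in> (reorient A R)\<inverse> \<Longrightarrow> s \<notin> supp u w"
    by (rule wfE_min[OF wf supp_ends(1)[OF uw]]) (rule that)
  have "is_sink R u w t" unfolding is_sink_def using t(1) t(2)[OF converseI] by blast
  then show "\<exists>t. is_sink R u w t" by blast
next
  fix t t' assume "is_sink R u w t" "is_sink R u w t'"
  then show "t = t'"
    using supp_clique[OF uw, of t t'] unfolding is_sink_def mem_reorient by blast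
qed

lemma is_sink_ends:
  assumes R: "R \<subseteq> A" and uw: "(u, w) \<in> A"
  shows "is_sink R u w u \<longleftrightarrow> (u, w) \<in> first_sinks R"
  using is_sink_iff[OF R uw, of u] supp_ends[OF uw] uw arc_irrefl by auto

lemma first_sinks_eq_iff_is_sink:
  assumes "biclosed R" "biclosed S"
  shows "first_sinks R = first_sinks S \<longleftrightarrow> (\<forall>(u, w)\<in>A. is_sink R u w = is_sink S u w)"
proof
  note RS = biclosedD(1)[OF assms(1)] biclosedD(1)[OF assms(2)]
  show "\<forall>(u, w)\<in>A. is_sink R u w = is_sink S u w" if eq: "first_sinks R = first_sinks S"
  proof -
    have "last_sinks R = last_sinks S" using first_sinks_eq_iff_last_sinks_eq assms eq by blast
    then show ?thesis using is_sink_iff[OF RS(1)] is_sink_iff[OF RS(2)] eq by fastforce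
  qed
  assume "\<forall>(u, w)\<in>A. is_sink R u w = is_sink S u w"
  then have "(u, w) \<in> first_sinks R \<longleftrightarrow> (u, w) \<in> first_sinks S" if "(u, w) \<in> A" for u w
    using is_sink_ends[OF RS(1) that] is_sink_ends[OF RS(2) that] that by fastforce
  then show "first_sinks R = first_sinks S" using sinks_subset(1) by auto
qed

text \<open>The join irreducible of the rope from \<open>u\<close> to \<open>w\<close> with empty
  last component. Thus \<open>first_sinks R\<close> records which of these join irreducibles lie
  below \<open>R\<close>.\<close>

definition upper_arcs :: "'v \<Rightarrow> 'v \<Rightarrow> 'v digraph" where
  "upper_arcs u w = {u} \<times> (supp u w - {u})"

text \<open>Its complement in \<open>A\<close> is the largest acyclic reorientation for which
  \<open>w\<close> is the sink of the support of \<open>(u, w)\<close>.\<close>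

definition lower_arcs :: "'v \<Rightarrow> 'v \<Rightarrow> 'v digraph" where
  "lower_arcs u w = (supp u w - {w}) \<times> {w}"

lemma first_sinks_iff_upper_arcs: "(u, w) \<in> first_sinks R \<longleftrightarrow> (u, w) \<in> A \<and> upper_arcs u w \<subseteq> R"
  by (auto simp: first_sinks_def upper_arcs_def)

lemma last_sinks_iff_lower_arcs:
  "R \<subseteq> A \<Longrightarrow> (u, w) \<in> last_sinks R \<longleftrightarrow> (u, w) \<in> A \<and> R \<subseteq> A - lower_arcs u w"
  by (auto simp: last_sinks_def lower_arcs_def)

text \<open>Two arcs with the common tail \<open>u\<close> never compose, so closedness is vacuous;
  coclosedness is convexity of the support. As \<open>w\<close> is the last vertex,
  \<open>(u, w)\<close> is never the arc that coclosedness asks for and can be removed.\<close>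

lemma biclosed_upper_arcs:
  assumes uw: "(u, w) \<in> A"
  shows "biclosed (upper_arcs u w)" "biclosed (upper_arcs u w - {(u, w)})"
proof -
  have sub: "upper_arcs u w \<subseteq> A" using supp_first[OF uw] by (auto simp: upper_arcs_def)
  have co: "(u, t) \<in> upper_arcs u w - {(u, w)}"
    if "(u, t) \<in> A" "(t, s) \<in> A" "(u, s) \<in> upper_arcs u w" for t s
  proof -
    have us: "(u, s) \<in> A" using that sub by blast
    have "t \<in> supp u s" using that us by (simp add: supp_eq)
    then have "t \<in> supp u w"
      using supp_convex[OF uw supp_ends(1)[OF uw] _ us] that(3) by (auto simp: upper_arcs_def)
    moreover have "t \<noteq> w" using supp_last[OF uw, of s] that arc_antisym arc_irrefl
      by (auto simp: upper_arcs_def)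
    ultimately show ?thesis using that(1) arc_irrefl by (auto simp: upper_arcs_def)
  qed
  show "biclosed (upper_arcs u w)"
    unfolding biclosed_def coclosed_def using sub co by (fastforce simp: upper_arcs_def)
  show "biclosed (upper_arcs u w - {(u, w)})"
    unfolding biclosed_def coclosed_def using sub co by (fastforce simp: upper_arcs_def)
qed

lemma biclosed_lower_arcs:
  assumes uw: "(u, w) \<in> A"
  shows "biclosed (lower_arcs u w)"
proof -
  have sub: "lower_arcs u w \<subseteq> A" using supp_last[OF uw] by (auto simp: lower_arcs_def)
  have co: "(t, w) \<in> lower_arcs u w"
    if "(s, t) \<in> A" "(t, w) \<in> A" "(s, w) \<in> lower_arcs u w" for t s
  proof -
    have sw: "(s, w) \<in> A" using that sub by blast
    have "t \<in> supp s w" using that sw by (simp add: supp_eq)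
    then have "t \<in> supp u w"
      using supp_convex[OF uw _ supp_ends(2)[OF uw] sw] that(3) by (auto simp: lower_arcs_def)
    then show ?thesis using that(2) arc_irrefl by (auto simp: lower_arcs_def)
  qed
  show ?thesis
    unfolding biclosed_def coclosed_def using sub co by (fastforce simp: lower_arcs_def)
qed

text \<open>A biclosed subset containing \<open>(u, w)\<close> contains every \<open>(u, s)\<close>:
  coclosedness offers \<open>(u, s)\<close> or \<open>(s, w)\<close>, and the latter does not start
  at \<open>u\<close>. So every proper biclosed subset omits \<open>(u, w)\<close>.\<close>

lemma upper_arcs_join_irreducible:
  assumes uw: "(u, w) \<in> A"
  shows "join_irreducible (AR A) (upper_arcs u w)"
    and "lower_cover (AR A) (upper_arcs u w) = upper_arcs u w - {(u, w)}"
proof -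
  interpret L: lattice "AR A" by (rule lattice_AR)
  have uw': "(u, w) \<in> upper_arcs u w"
    using supp_ends[OF uw] uw arc_irrefl by (auto simp: upper_arcs_def)
  have below: "R \<subseteq> upper_arcs u w - {(u, w)}" if R: "biclosed R" "R \<subset> upper_arcs u w" for R
  proof (rule ccontr)
    assume "\<not> ?thesis"
    then have uwR: "(u, w) \<in> R" using R(2) by blast
    have "(u, s) \<in> R" if s: "s \<in> supp u w - {u}" for s
    proof (cases "s = w")
      case False
      then have "(u, s) \<in> A" "(s, w) \<in> A" using s supp_first[OF uw] supp_last[OF uw] by auto
      moreover have "(s, w) \<notin> R" using s R(2) by (auto simp: upper_arcs_def)
      ultimately show ?thesis using biclosedD(3)[OF R(1)] uwR by blast
    qed (use uwR in simp)
    then show False using R(2) by (auto simp: upper_arcs_def)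
  qed
  have "covered_by (AR A) (upper_arcs u w - {(u, w)}) (upper_arcs u w)"
    using biclosed_upper_arcs[OF uw] uw' below unfolding covered_by_def by auto
  then show "join_irreducible (AR A) (upper_arcs u w)"
    "lower_cover (AR A) (upper_arcs u w) = upper_arcs u w - {(u, w)}"
    using L.lower_coverI below by auto
qed

lemma rope_join_irreducible_eq:
  assumes "rope A u w N {}"
  shows "(u, w) \<in> A" "rope_join_irreducible A u w N {} = upper_arcs u w"
proof -
  show uw: "(u, w) \<in> A" using assms by (simp add: rope_def)
  have "N = supp u w - {u, w}" using assms by (simp add: rope_def)
  then show "rope_join_irreducible A u w N {} = upper_arcs u w"
    using supp_ends[OF uw] supp_first[OF uw] uw arc_irrefl
    by (auto simp: rope_join_irreducible_def upper_arcs_def)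
qed

lemma rope_join_irreducibles:
  "{rope_join_irreducible A u v N {} |u v N. rope A u v N {}} = {upper_arcs u w |u w. (u, w) \<in> A}"
proof -
  have "rope A u w (supp u w - {u, w}) {}" if "(u, w) \<in> A" for u w
    using that by (simp add: rope_def)
  then show ?thesis using rope_join_irreducible_eq by fastforce
qed

definition sinks_congruence :: "('v digraph \<times> 'v digraph) set" where
  "sinks_congruence = {(R, S). biclosed R \<and> biclosed S \<and> first_sinks R = first_sinks S}"

lemma sinks_congruence: "lattice_congruence (AR A) sinks_congruence"
proof -
  interpret L: lattice "AR A" by (rule lattice_AR)
  have meet: "first_sinks (R \<sqinter>\<^bsub>AR A\<^esub> S) = first_sinks R \<inter> first_sinks S"
    if RS: "biclosed R" "biclosed S" for R S
  proof -
    let ?m = "R \<sqinter>\<^bsub>AR A\<^esub> S"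
    have "?m \<subseteq> R" "?m \<subseteq> S" using L.meet_left[of R S] L.meet_right[of R S] RS by auto
    moreover have "T \<subseteq> ?m" if "biclosed T" "T \<subseteq> R" "T \<subseteq> S" for T
      using L.meet_le[of T R S] RS that by auto
    ultimately show ?thesis
      using biclosed_upper_arcs(1) by (auto simp: first_sinks_iff_upper_arcs) blast+
  qed
  have join: "last_sinks (R \<squnion>\<^bsub>AR A\<^esub> S) = last_sinks R \<inter> last_sinks S"
    if RS: "biclosed R" "biclosed S" for R S
  proof -
    let ?j = "R \<squnion>\<^bsub>AR A\<^esub> S"
    have "R \<subseteq> ?j" "S \<subseteq> ?j" using L.join_left[of R S] L.join_right[of R S] RS by auto
    moreover have "?j \<subseteq> T" if "biclosed T" "R \<subseteq> T" "S \<subseteq> T" for T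
      using L.join_le[of R T S] RS that by auto
    moreover have "biclosed (A - lower_arcs u w)" if "(u, w) \<in> A" for u w
      using biclosed_complement biclosed_lower_arcs that by blast
    moreover have "R \<subseteq> A" "S \<subseteq> A" "?j \<subseteq> A"
      using biclosedD(1) RS L.join_closed[of R S] by auto
    ultimately have "(u, w) \<in> last_sinks ?j \<longleftrightarrow> (u, w) \<in> last_sinks R \<and> (u, w) \<in> last_sinks S"
      for u w
      using last_sinks_iff_lower_arcs[of R u w] last_sinks_iff_lower_arcs[of S u w]
        last_sinks_iff_lower_arcs[of ?j u w] by (meson order_trans)
    then show ?thesis by auto
  qed
  have closed: "biclosed (R \<squnion>\<^bsub>AR A\<^esub> S)" "biclosed (R \<sqinter>\<^bsub>AR A\<^esub> S)" if "biclosed R" "biclosed S" for R S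
    using L.join_closed[of R S] L.meet_closed[of R S] that by auto
  have "equiv (carrier (AR A)) sinks_congruence"
    by (rule equivI) (auto simp: sinks_congruence_def refl_on_def sym_def trans_def)
  then show ?thesis
    unfolding lattice_congruence_def sinks_congruence_def
    using closed meet join first_sinks_eq_iff_last_sinks_eq by auto
qed

text \<open>If \<open>J\<close> is not contracted, some \<open>upper_arcs u w\<close> lies below
  \<open>J\<close> but not below its lower cover. Everything strictly below \<open>J\<close> lies
  below that cover, so \<open>J\<close> equals \<open>upper_arcs u w\<close>.\<close>

lemma uncontracted_sinks_congruence:
  "{J. join_irreducible (AR A) J \<and> \<not> contracts (AR A) sinks_congruence J} =
   {upper_arcs u w |u w. (u, w) \<in> A}"
proof -
  interpret L: lattice "AR A" by (rule lattice_AR)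
  have fin: "finite (carrier (AR A))" by (rule finite)
  have "\<exists>u w. (u, w) \<in> A \<and> J = upper_arcs u w"
    if J: "join_irreducible (AR A) J" "\<not> contracts (AR A) sinks_congruence J" for J
  proof -
    let ?c = "lower_cover (AR A) J"
    note lc = L.lower_cover_properties[OF fin J(1)]
    have bic: "biclosed ?c" "biclosed J" "?c \<subset> J" using lc(1) by (auto simp: covered_by_def)
    then have "first_sinks ?c \<noteq> first_sinks J"
      using J(2) by (auto simp: contracts_def sinks_congruence_def)
    then obtain u w where uw: "(u, w) \<in> A" "upper_arcs u w \<subseteq> J" "\<not> upper_arcs u w \<subseteq> ?c"
      using bic(3) first_sinks_iff_upper_arcs by fastforce
    then have "\<not> upper_arcs u w \<subset> J"
      using lc(2)[of "upper_arcs u w"] biclosed_upper_arcs(1) by auto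
    then show ?thesis using uw by blast
  qed
  moreover have "\<not> contracts (AR A) sinks_congruence (upper_arcs u w)" if "(u, w) \<in> A" for u w
  proof -
    have "(u, w) \<in> upper_arcs u w"
      using supp_ends[OF that] that arc_irrefl by (auto simp: upper_arcs_def)
    then have "(u, w) \<in> first_sinks (upper_arcs u w)"
      "(u, w) \<notin> first_sinks (upper_arcs u w - {(u, w)})"
      using that by (auto simp: first_sinks_iff_upper_arcs)
    then show ?thesis
      by (auto simp: contracts_def sinks_congruence_def upper_arcs_join_irreducible(2)[OF that])
  qed
  ultimately show ?thesis using upper_arcs_join_irreducible(1) by blast
qed

lemma sylvester_congruence_eq: "sylvester_congruence A = sinks_congruence"
  unfolding sylvester_congruence_def rope_join_irreducibles
proof (rule the_equality)
  interpret L: lattice "AR A" by (rule lattice_AR)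
  fix r
  assume "lattice_congruence (AR A) r \<and>
    {J. join_irreducible (AR A) J \<and> \<not> contracts (AR A) r J} = {upper_arcs u w |u w. (u, w) \<in> A}"
  then show "r = sinks_congruence"
    using L.congruence_unique[of r sinks_congruence] sinks_congruence uncontracted_sinks_congruence
    by simp
qed (use sinks_congruence uncontracted_sinks_congruence in blast)

end

section \<open>Normal fans of polytopes\<close>

text \<open>Both \<open>a\<close> and \<open>b\<close> are maximal at \<open>z\<close>, while their
  positive combination \<open>c\<close> is constant on \<open>F\<close>; hence each of
  \<open>a\<close> and \<open>b\<close> is constant on \<open>F\<close>.\<close>

lemma normal_cone_face_of:
  assumes "F \<subseteq> P" "z \<in> F"
  shows "normal_cone P F face_of normal_cone P {z}"
  unfolding face_of_def
proof (intro conjI ballI impI)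
  show "normal_cone P F \<subseteq> normal_cone P {z}" using assms by (auto simp: normal_cone_def)
  have "normal_cone P F = (\<Inter>x\<in>F. \<Inter>y\<in>P. {v. (y - x) \<bullet> v \<le> 0})"
    by (auto simp: normal_cone_def inner_diff_left inner_diff_right inner_commute)
  then show "convex (normal_cone P F)"
    by (simp add: convex_INT convex_halfspace_le)
  fix a b c
  assume ab: "a \<in> normal_cone P {z}" "b \<in> normal_cone P {z}"
    and c: "c \<in> normal_cone P F" "c \<in> open_segment a b"
  obtain u where u: "0 < u" "u < 1" "c = (1 - u) *\<^sub>R a + u *\<^sub>R b"
    using c(2) by (auto simp: in_segment)
  have "a \<bullet> x = a \<bullet> z \<and> b \<bullet> x = b \<bullet> z" if x: "x \<in> F" for x
  proof -
    have le: "a \<bullet> x \<le> a \<bullet> z" "b \<bullet> x \<le> b \<bullet> z" using ab x assms(1) by (auto simp: normal_cone_def)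
    moreover have "c \<bullet> z \<le> c \<bullet> x" using c(1) x assms by (auto simp: normal_cone_def)
    then have "(1 - u) * (a \<bullet> z - a \<bullet> x) + u * (b \<bullet> z - b \<bullet> x) \<le> 0"
      using u(3) by (simp add: inner_add_left algebra_simps)
    moreover have "0 \<le> (1 - u) * (a \<bullet> z - a \<bullet> x)" "0 \<le> u * (b \<bullet> z - b \<bullet> x)"
      using le u by auto
    ultimately have "(1 - u) * (a \<bullet> z - a \<bullet> x) = 0" "u * (b \<bullet> z - b \<bullet> x) = 0" by linarith+
    then show ?thesis using u by auto
  qed
  then show "a \<in> normal_cone P F" "b \<in> normal_cone P F"
    using ab by (simp_all add: normal_cone_def)
qed

text \<open>For \<open>c\<close> in the relative interior of \<open>G\<close>, let \<open>F\<close>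
  be the face on which \<open>c\<close> is maximal. Then \<open>G\<close> lies in the face
  \<open>normal_cone P F\<close>, which contains \<open>c\<close>. Conversely \<open>c\<close> can
  be pushed slightly away from any \<open>d\<close> in \<open>normal_cone P F\<close> within the
  cone at \<open>z\<close>, so the face property of \<open>G\<close> captures
  \<open>d\<close>.\<close>

lemma face_of_normal_cone:
  assumes P: "polytope P" and z: "z \<in> P" and G: "G face_of normal_cone P {z}" "G \<noteq> {}"
  shows "\<exists>F. F face_of P \<and> F \<noteq> {} \<and> G = normal_cone P F"
proof -
  obtain V where V: "finite V" "P = convex hull V" using P by (auto simp: polytope_def)
  have "rel_interior G \<noteq> {}" using G face_of_imp_convex rel_interior_eq_empty by blast
  then obtain c where c: "c \<in> rel_interior G" by blast
  then have cG: "c \<in> G" using rel_interior_subset by blast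
  have GN: "G \<subseteq> normal_cone P {z}" using G(1) face_of_imp_subset by blast
  then have cN: "c \<bullet> y \<le> c \<bullet> z" if "y \<in> P" for y using cG that by (auto simp: normal_cone_def)
  define F where "F = P \<inter> {x. c \<bullet> x = c \<bullet> z}"
  have zF: "z \<in> F" using z by (simp add: F_def)
  have F: "F face_of P"
    unfolding F_def by (rule face_of_Int_supporting_hyperplane_le)
      (use cN polytope_imp_convex[OF P] in auto)
  have "F \<subseteq> P" by (auto simp: F_def)
  note NF = normal_cone_face_of[OF this zF]
  have "c \<in> normal_cone P F" using cN by (auto simp: normal_cone_def F_def)
  then have "G \<subseteq> normal_cone P F"
    using subset_of_face_of[OF NF GN] c by blast
  moreover have "d \<in> G" if d: "d \<in> normal_cone P F" for d
  proof (cases "d = c")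
    case False
    \<comment> \<open>Finitely many generators make one common \<open>e\<close> possible: on
      \<open>F\<close> both functionals equal their value at \<open>z\<close>, and off
      \<open>F\<close> the inequality is strict at \<open>e = 0\<close>.\<close>
    have "\<forall>v\<in>V. eventually (\<lambda>e. c \<bullet> (v - z) + e * ((c - d) \<bullet> (v - z)) \<le> 0) (at_right 0)"
    proof
      fix v assume "v \<in> V"
      then have v: "v \<in> P" using V hull_inc by fast
      show "eventually (\<lambda>e. c \<bullet> (v - z) + e * ((c - d) \<bullet> (v - z)) \<le> 0) (at_right 0)"
      proof (cases "c \<bullet> v = c \<bullet> z")
        case True
        then have "v \<in> F" using v by (simp add: F_def)
        then have "d \<bullet> v = d \<bullet> z"
          using d v z zF by (intro antisym) (auto simp: normal_cone_def)
        with True show ?thesis by (simp add: inner_diff_left inner_diff_right)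
      next
        case False
        then have neg: "c \<bullet> (v - z) + 0 * ((c - d) \<bullet> (v - z)) < 0"
          using cN[OF v] by (simp add: inner_diff_right)
        have "((\<lambda>e. c \<bullet> (v - z) + e * ((c - d) \<bullet> (v - z))) \<longlongrightarrow>
            c \<bullet> (v - z) + 0 * ((c - d) \<bullet> (v - z))) (at_right 0)"
          by (intro tendsto_intros)
        from order_tendstoD(2)[OF this neg] show ?thesis
          by eventually_elim simp
      qed
    qed
    then have "eventually (\<lambda>e. \<forall>v\<in>V. c \<bullet> (v - z) + e * ((c - d) \<bullet> (v - z)) \<le> 0) (at_right (0::real))"
      using V(1) by (simp add: eventually_ball_finite)
    moreover have "eventually (\<lambda>e. e > 0) (at_right (0::real))"
      by (simp add: eventually_at_right_less)
    ultimately have "eventually (\<lambda>e. e > 0 \<and> (\<forall>v\<in>V. c \<bullet> (v - z) + e * ((c - d) \<bullet> (v - z)) \<le> 0))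
        (at_right (0::real))"
      by eventually_elim simp
    from eventually_happens'[OF trivial_limit_at_right_real this]
    obtain e where e: "e > 0" "\<And>v. v \<in> V \<Longrightarrow> c \<bullet> (v - z) + e * ((c - d) \<bullet> (v - z)) \<le> 0"
      by blast
    define c' where "c' = c + e *\<^sub>R (c - d)"
    have "V \<subseteq> {x. c' \<bullet> x \<le> c' \<bullet> z}"
      using e(2) by (auto simp: c'_def inner_add_left inner_diff_left inner_diff_right algebra_simps)
    then have "P \<subseteq> {x. c' \<bullet> x \<le> c' \<bullet> z}"
      unfolding V(2) by (intro hull_minimal convex_halfspace_le)
    then have c': "c' \<in> normal_cone P {z}" by (auto simp: normal_cone_def)
    have dN: "d \<in> normal_cone P {z}" using d zF by (auto simp: normal_cone_def)
    \<comment> \<open>The weight that solves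
      \<open>c = (1 - u) *\<^sub>R d + u *\<^sub>R c'\<close>.\<close>
    define u where "u = 1 / (1 + e)"
    have u: "0 < u" "u < 1" "u + u * e = 1" using e(1) by (simp_all add: u_def field_simps)
    have "(1 - u) *\<^sub>R d + u *\<^sub>R c' = (u + u * e) *\<^sub>R c + (1 - (u + u * e)) *\<^sub>R d"
      by (simp add: c'_def algebra_simps)
    then have "c = (1 - u) *\<^sub>R d + u *\<^sub>R c'" using u(3) by simp
    moreover have "d \<noteq> c'"
    proof
      assume "d = c'"
      then have "(1 + e) *\<^sub>R (c - d) = 0" by (simp add: c'_def algebra_simps)
      then show False using False e(1) by simp
    qed
    ultimately have "c \<in> open_segment d c'"
      using u(1,2) unfolding in_segment by blast
    then show ?thesis using G(1) dN c' cG unfolding face_of_def by blast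
  qed (use cG in simp)
  ultimately show ?thesis using F zF by blast
qed

text \<open>Points of \<open>Z\<close> may be non-extreme, so that all \<open>vert R\<close> can be
  taken without checking that each is a vertex. A face \<open>F\<close> has an extreme point, which
  is extreme in \<open>P\<close>, and its cone contains \<open>normal_cone P F\<close> as a
  face.\<close>

lemma normal_fan_eq:
  assumes P: "polytope P" and Z: "Z \<subseteq> P" "\<And>z. z extreme_point_of P \<Longrightarrow> z \<in> Z"
  shows "normal_fan P = {G. G \<noteq> {} \<and> (\<exists>z\<in>Z. G face_of normal_cone P {z})}"
proof (intro Set.equalityI subsetI)
  fix G assume "G \<in> normal_fan P"
  then obtain F where F: "F face_of P" "F \<noteq> {}" "G = normal_cone P F" by (auto simp: normal_fan_def)
  then have "compact F" "convex F" using P polytope_imp_compact polytope_imp_convex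
    by (auto intro: face_of_imp_compact face_of_imp_convex)
  then obtain z where z: "z extreme_point_of F"
    using extreme_point_exists_convex F(2) by blast
  then have "z \<in> F" "z extreme_point_of P"
    using extreme_point_of_face[OF F(1)] by auto
  moreover have "0 \<in> G" using F by (auto simp: normal_cone_def)
  ultimately show "G \<in> {G. G \<noteq> {} \<and> (\<exists>z\<in>Z. G face_of normal_cone P {z})}"
    using F normal_cone_face_of[of F P z] Z(2) face_of_imp_subset by blast
next
  fix G assume "G \<in> {G. G \<noteq> {} \<and> (\<exists>z\<in>Z. G face_of normal_cone P {z})}"
  then show "G \<in> normal_fan P"
    using face_of_normal_cone[OF P] Z(1) unfolding normal_fan_def by blast
qed

section \<open>The vertices of the associahedron\<close>

lemma inner_axis_1: "c \<bullet> axis t (1::real) = c $ t"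
  by (simp add: inner_axis)

lemma inner_simplex_le:
  fixes c :: "real ^ 'v::finite"
  assumes "y \<in> convex hull {axis t 1 |t. t \<in> S}" "\<And>t. t \<in> S \<Longrightarrow> c $ t \<le> b"
  shows "c \<bullet> y \<le> b"
proof -
  have "convex hull {axis t 1 |t. t \<in> S} \<subseteq> {y. c \<bullet> y \<le> b}"
    using assms(2) by (intro hull_minimal convex_halfspace_le) (auto simp: inner_axis_1)
  then show ?thesis using assms(1) by blast
qed

context skeletal_dag
begin

definition sink :: "'v digraph \<Rightarrow> 'v \<Rightarrow> 'v \<Rightarrow> 'v" where
  "sink R u w = (THE t. is_sink R u w t)"

lemma is_sink_sink: "biclosed R \<Longrightarrow> (u, w) \<in> A \<Longrightarrow> is_sink R u w (sink R u w)"
  unfolding sink_def by (rule theI'[OF ex_is_sink])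

lemma sink_eqI: "biclosed R \<Longrightarrow> (u, w) \<in> A \<Longrightarrow> is_sink R u w t \<Longrightarrow> sink R u w = t"
  unfolding sink_def by (rule the1_equality[OF ex_is_sink])

lemma sink_in_supp: "biclosed R \<Longrightarrow> (u, w) \<in> A \<Longrightarrow> sink R u w \<in> supp u w"
  using is_sink_sink by (auto simp: is_sink_def)

lemma first_sinks_eq_iff_sink:
  assumes "biclosed R" "biclosed S"
  shows "first_sinks R = first_sinks S \<longleftrightarrow> (\<forall>(u, w)\<in>A. sink R u w = sink S u w)"
proof -
  have "is_sink R u w = is_sink S u w \<longleftrightarrow> sink R u w = sink S u w" if "(u, w) \<in> A" for u w
  proof
    assume "sink R u w = sink S u w"
    then show "is_sink R u w = is_sink S u w"
      using is_sink_sink[OF assms(1) that] is_sink_sink[OF assms(2) that]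
        ex_is_sink[OF assms(1) that] ex_is_sink[OF assms(2) that] by (intro ext) metis
  qed (simp add: sink_def)
  then show ?thesis using first_sinks_eq_iff_is_sink[OF assms] by auto
qed

lemma cone_le_sink:
  assumes "biclosed R" "c \<in> reorientation_cone A R" "(u, w) \<in> A" "s \<in> supp u w"
  shows "c $ s \<le> c $ sink R u w"
proof (cases "s = sink R u w")
  case False
  have "(s, sink R u w) \<in> reorient A R"
    using is_sink_sink[OF assms(1,3)] supp_clique[OF assms(3,4) sink_in_supp[OF assms(1,3)] False]
      assms(4) unfolding is_sink_def mem_reorient by blast
  then show ?thesis using assms(2) by (auto simp: reorientation_cone_def)
qed simp

text \<open>Vertices are compared by \<open>c\<close>, ties being broken by \<open>R\<close>: a
  directed cycle would have constant \<open>c\<close> and so be a cycle of \<open>R\<close>. Sinks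
  of \<open>R\<close> that already maximise \<open>c\<close> survive the refinement.\<close>

lemma lexicographic_reorientation:
  fixes c :: "real ^ 'v"
  assumes R: "biclosed R"
  obtains S where "biclosed S" "c \<in> reorientation_cone A S"
    "\<And>u w. (u, w) \<in> A \<Longrightarrow> (\<And>s. s \<in> supp u w \<Longrightarrow> c $ s \<le> c $ sink R u w) \<Longrightarrow> sink S u w = sink R u w"
proof -
  define S where "S = {(u, v) \<in> A. c $ v < c $ u \<or> c $ u = c $ v \<and> (u, v) \<in> R}"
  have RA: "R \<subseteq> A" using biclosedD(1)[OF R] .
  have arc: "c $ u < c $ v \<or> c $ u = c $ v \<and> (u, v) \<in> reorient A R" if "(u, v) \<in> reorient A S" for u v
    using that arc_antisym by (auto simp: mem_reorient S_def)
  have "c $ u < c $ v \<or> c $ u = c $ v \<and> (u, v) \<in> (reorient A R)\<^sup>+" if "(u, v) \<in> (reorient A S)\<^sup>+" for u v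
    using that
  proof (induction rule: trancl_induct)
    case (base y)
    then show ?case using arc by blast
  next
    case (step y z)
    then show ?case using arc[OF step(2)] by (auto intro: trancl_into_trancl)
  qed
  then have "acyclic (reorient A S)"
    using acyclic_reorient_biclosed[OF R] by (fastforce simp: acyclic_def)
  then have S: "biclosed S"
    using acyclic_reorientations_eq by (auto simp: acyclic_reorientations_def S_def)
  moreover have "c \<in> reorientation_cone A S"
    using arc by (fastforce simp: reorientation_cone_def)
  moreover have "sink S u w = sink R u w"
    if uw: "(u, w) \<in> A" and le: "\<And>s. s \<in> supp u w \<Longrightarrow> c $ s \<le> c $ sink R u w" for u w
  proof (rule sink_eqI[OF S uw])
    have "(sink R u w, s) \<notin> reorient A S" if "s \<in> supp u w" for s
      using is_sink_sink[OF R uw] that le[OF that] arc[of "sink R u w" s] by (auto simp: is_sink_def)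
    then show "is_sink S u w (sink R u w)"
      using sink_in_supp[OF R uw] by (simp add: is_sink_def)
  qed
  ultimately show ?thesis using that by blast
qed

lemma biclosed_empty: "biclosed {}"
  by (simp add: biclosed_def coclosed_def)

lemma ex_reorientation_cone:
  fixes c :: "real ^ 'v"
  obtains S where "biclosed S" "c \<in> reorientation_cone A S"
  by (rule lexicographic_reorientation[OF biclosed_empty, of c])

section \<open>Vertices of the Minkowski sum and their normal cones\<close>

abbreviation arc_simplex :: "'v \<times> 'v \<Rightarrow> (real ^ 'v) set" where
  "arc_simplex a \<equiv> convex hull {axis t 1 |t. t \<in> supp (fst a) (snd a)}"

lemma associahedron_M_eq: "associahedron_M A = (\<Sum>a\<in>A. arc_simplex a)"
proof -
  have "path_simplex p = arc_simplex (hd p, last p)" if "p \<in> reduced_paths" for p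
    using set_reduced_path[OF that] by (simp add: path_simplex_def)
  then have "associahedron_M A = (\<Sum>p\<in>reduced_paths. arc_simplex (hd p, last p))"
    unfolding associahedron_M_def reduced_paths_def[symmetric] by (rule sum.cong[OF refl])
  also have "\<dots> = (\<Sum>a\<in>A. arc_simplex a)"
    by (rule sum.reindex_bij_betw[OF bij_betw_reduced_paths])
  finally show ?thesis .
qed

lemma polytope_associahedron_M: "polytope (associahedron_M A)"
proof -
  have "associahedron_M A = convex hull (\<Sum>a\<in>A. {axis t 1 |t. t \<in> supp (fst a) (snd a)})"
    unfolding associahedron_M_eq by (rule convex_hull_set_sum[symmetric])
  moreover have "finite (\<Sum>a\<in>A. {axis t (1::real) |t. t \<in> supp (fst a) (snd a)})"
    by (rule finite_set_sum) auto
  ultimately show ?thesis unfolding polytope_def by blast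
qed

lemma mem_associahedron_M:
  "y \<in> associahedron_M A \<longleftrightarrow> (\<exists>f. (\<forall>a\<in>A. f a \<in> arc_simplex a) \<and> y = (\<Sum>a\<in>A. f a))"
  unfolding associahedron_M_eq set_sum_alt[OF finite] by auto

definition vert :: "'v digraph \<Rightarrow> real ^ 'v" where
  "vert R = (\<Sum>a\<in>A. axis (sink R (fst a) (snd a)) 1)"

lemma inner_vert: "c \<bullet> vert R = (\<Sum>a\<in>A. c $ sink R (fst a) (snd a))"
  by (simp add: vert_def inner_sum_right inner_axis_1)

lemma vert_in_associahedron_M:
  assumes "biclosed R"
  shows "vert R \<in> associahedron_M A"
  unfolding mem_associahedron_M vert_def
  using sink_in_supp[OF assms]
  by (intro exI[of _ "\<lambda>a. axis (sink R (fst a) (snd a)) 1"]) (auto intro!: hull_inc)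

lemma inner_le_vert:
  assumes "\<And>u w s. (u, w) \<in> A \<Longrightarrow> s \<in> supp u w \<Longrightarrow> c $ s \<le> c $ sink R u w"
    and "y \<in> associahedron_M A"
  shows "c \<bullet> y \<le> c \<bullet> vert R"
proof -
  obtain f where f: "\<And>a. a \<in> A \<Longrightarrow> f a \<in> arc_simplex a" "y = (\<Sum>a\<in>A. f a)"
    using assms(2) mem_associahedron_M by blast
  have "c \<bullet> f a \<le> c $ sink R (fst a) (snd a)" if "a \<in> A" for a
    using inner_simplex_le[OF f(1)[OF that]] assms(1) that by simp
  then show ?thesis by (simp add: f(2) inner_vert inner_sum_right sum_mono)
qed

lemma normal_cone_vert:
  assumes R: "biclosed R"
  shows "normal_cone (associahedron_M A) {vert R} =
    {c. \<forall>(u, w)\<in>A. \<forall>s\<in>supp u w. c $ s \<le> c $ sink R u w}"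
proof (intro Set.equalityI subsetI)
  fix c :: "real ^ 'v" assume "c \<in> {c. \<forall>(u, w)\<in>A. \<forall>s\<in>supp u w. c $ s \<le> c $ sink R u w}"
  then have "c \<bullet> y \<le> c \<bullet> vert R" if "y \<in> associahedron_M A" for y
    using inner_le_vert[OF _ that, of c R] by fastforce
  then show "c \<in> normal_cone (associahedron_M A) {vert R}" by (simp add: normal_cone_def)
next
  fix c :: "real ^ 'v" assume c: "c \<in> normal_cone (associahedron_M A) {vert R}"
  have "c $ s \<le> c $ sink R u w" if uw: "(u, w) \<in> A" and s: "s \<in> supp u w" for u w s
  proof -
    let ?g = "\<lambda>a. axis (sink R (fst a) (snd a)) (1::real)"
    \<comment> \<open>Only the summand of the arc \<open>(u, w)\<close> moves, from its sink to
      \<open>s\<close>; the other summands cancel in the comparison with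
      \<open>vert R\<close>.\<close>
    let ?f = "?g((u, w) := axis s 1)"
    have "(\<Sum>a\<in>A. ?f a) \<in> associahedron_M A"
      unfolding mem_associahedron_M
      using sink_in_supp[OF R] s by (intro exI[of _ ?f]) (auto intro!: hull_inc)
    then have "c \<bullet> (\<Sum>a\<in>A. ?f a) \<le> c \<bullet> (\<Sum>a\<in>A. ?g a)"
      using c by (auto simp: normal_cone_def vert_def)
    moreover have "(\<Sum>a\<in>A. ?f a) = axis s 1 + (\<Sum>a\<in>A - {(u, w)}. ?g a)"
      by (simp add: sum.remove[OF finite uw])
    moreover have "(\<Sum>a\<in>A. ?g a) = axis (sink R u w) 1 + (\<Sum>a\<in>A - {(u, w)}. ?g a)"
      by (simp add: sum.remove[OF finite uw])
    ultimately show ?thesis by (simp add: inner_add_right inner_axis_1)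
  qed
  then show "c \<in> {c. \<forall>(u, w)\<in>A. \<forall>s\<in>supp u w. c $ s \<le> c $ sink R u w}" by blast
qed

text \<open>A functional maximal at \<open>vert R\<close> need not lie in the cone of
  \<open>R\<close>. Refining its order by \<open>R\<close> gives a reorientation with the same
  sinks, hence in the class of \<open>R\<close>, whose cone contains it.\<close>

lemma chamber_eq_normal_cone:
  assumes R: "biclosed R"
  shows "(\<Union>S\<in>sinks_congruence `` {R}. reorientation_cone A S) =
    normal_cone (associahedron_M A) {vert R}"
proof (intro Set.equalityI subsetI)
  fix c assume "c \<in> (\<Union>S\<in>sinks_congruence `` {R}. reorientation_cone A S)"
  then obtain S where S: "biclosed S" "first_sinks R = first_sinks S" "c \<in> reorientation_cone A S"
    by (auto simp: sinks_congruence_def)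
  then have "\<forall>(u, w)\<in>A. sink R u w = sink S u w" using first_sinks_eq_iff_sink[OF R S(1)] by blast
  then show "c \<in> normal_cone (associahedron_M A) {vert R}"
    unfolding normal_cone_vert[OF R] using cone_le_sink[OF S(1,3)] by auto
next
  fix c assume "c \<in> normal_cone (associahedron_M A) {vert R}"
  then have c: "c $ s \<le> c $ sink R u w" if "(u, w) \<in> A" "s \<in> supp u w" for u w s
    using that unfolding normal_cone_vert[OF R] by blast
  obtain S where S: "biclosed S" "c \<in> reorientation_cone A S"
    "\<And>u w. (u, w) \<in> A \<Longrightarrow> (\<And>s. s \<in> supp u w \<Longrightarrow> c $ s \<le> c $ sink R u w) \<Longrightarrow> sink S u w = sink R u w"
    using lexicographic_reorientation[OF R, of c] by blast
  have "\<forall>(u, w)\<in>A. sink R u w = sink S u w" using S(3) c by fastforce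
  then have "first_sinks R = first_sinks S" using first_sinks_eq_iff_sink[OF R S(1)] by blast
  then show "c \<in> (\<Union>S\<in>sinks_congruence `` {R}. reorientation_cone A S)"
    using R S by (auto simp: sinks_congruence_def)
qed

lemma sylvester_chambers_eq:
  "sylvester_chambers A = {normal_cone (associahedron_M A) {vert R} |R. biclosed R}"
proof -
  have "sylvester_chambers A =
      {\<Union>S\<in>sinks_congruence `` {R}. reorientation_cone A S |R. biclosed R}"
    unfolding sylvester_chambers_def sylvester_congruence_eq acyclic_reorientations_eq quotient_def
    by auto
  then show ?thesis using chamber_eq_normal_cone by (auto; blast)
qed

text \<open>An extreme point of a polytope is exposed, hence the only maximiser of some
  \<open>c\<close>; this \<open>c\<close> lies in the cone of some \<open>R\<close>, and
  \<open>vert R\<close> maximises it too.\<close>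

lemma extreme_point_is_vert:
  assumes z: "z extreme_point_of associahedron_M A"
  shows "\<exists>R. biclosed R \<and> z = vert R"
proof -
  have "{z} exposed_face_of associahedron_M A"
    using z exposed_face_of_polyhedron[OF polytope_imp_polyhedron[OF polytope_associahedron_M]]
    by (simp add: face_of_singleton)
  then obtain c b where cb: "associahedron_M A \<subseteq> {x. c \<bullet> x \<le> b}" "{z} = associahedron_M A \<inter> {x. c \<bullet> x = b}"
    by (auto simp: exposed_face_of_def)
  obtain R where R: "biclosed R" "c \<in> reorientation_cone A R" using ex_reorientation_cone by blast
  have "z \<in> associahedron_M A" "c \<bullet> z = b" using cb(2) by auto
  then have "b \<le> c \<bullet> vert R" using inner_le_vert[of c R z] cone_le_sink[OF R] by auto
  then have "vert R \<in> {z}"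
    unfolding cb(2) using vert_in_associahedron_M[OF R(1)] cb(1) by auto
  then show ?thesis using R by blast
qed

lemma sylvester_fan_eq: "sylvester_fan A = normal_fan (associahedron_M A)"
proof -
  have "normal_fan (associahedron_M A) =
      {G. G \<noteq> {} \<and> (\<exists>z\<in>vert ` {R. biclosed R}. G face_of normal_cone (associahedron_M A) {z})}"
    using vert_in_associahedron_M extreme_point_is_vert
    by (intro normal_fan_eq polytope_associahedron_M) auto
  then show ?thesis unfolding sylvester_fan_def sylvester_chambers_eq by auto
qed

end

section \<open>The halfspace description\<close>

lemma indicator_vec_nth: "indicator_vec U $ t = (if t \<in> U then 1 else 0)"
  by (simp add: indicator_vec_def axis_def)

lemma inner_indicator_vec: "indicator_vec U \<bullet> x = (\<Sum>u\<in>U. x $ u)"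
  by (simp add: indicator_vec_def inner_sum_left inner_axis')

lemma inner_simplex_eq:
  fixes c :: "real ^ 'v::finite"
  assumes "y \<in> convex hull {axis t 1 |t. t \<in> S}" "\<And>t. t \<in> S \<Longrightarrow> c $ t = b"
  shows "c \<bullet> y = b"
  using inner_simplex_le[OF assms(1), of c b] inner_simplex_le[OF assms(1), of "- c" "- b"] assms(2)
  by auto

lemma mem_orthogonal_comp_span: "x \<in> (span S)\<^sup>\<bottom> \<longleftrightarrow> (\<forall>s\<in>S. s \<bullet> x = 0)"
proof
  assume "x \<in> (span S)\<^sup>\<bottom>"
  then show "\<forall>s\<in>S. s \<bullet> x = 0" by (auto simp: orthogonal_comp_def orthogonal_def span_base)
next
  assume S: "\<forall>s\<in>S. s \<bullet> x = 0"
  have "z \<bullet> x = 0" if "z \<in> span S" for z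
    using that by (rule span_induct) (use S in \<open>auto simp: subspace_def inner_add_left\<close>)
  then show "x \<in> (span S)\<^sup>\<bottom>" by (auto simp: orthogonal_comp_def orthogonal_def)
qed

text \<open>Abel summation along the level sets of \<open>c\<close>: the induction truncates \<open>c\<close> at its second
  largest value.\<close>

lemma sum_mult_nonpos_if_level_sums_nonneg:
  fixes c d :: "'a \<Rightarrow> real"
  assumes "finite V" "sum d V = 0" "\<And>l. sum d {v \<in> V. c v \<le> l} \<ge> 0"
  shows "(\<Sum>v\<in>V. c v * d v) \<le> 0"
  using assms(3)
proof (induction "card (c ` V)" arbitrary: c rule: less_induct)
  case less
  show ?case
  proof (cases "\<exists>k. \<forall>v\<in>V. c v = k")
    case True
    then obtain k where "\<forall>v\<in>V. c v = k" by blast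
    then have "(\<Sum>v\<in>V. c v * d v) = k * sum d V" by (simp add: sum_distrib_left)
    then show ?thesis using assms(2) by simp
  next
    case False
    then have ne: "V \<noteq> {}" by blast
    define m where "m = Max (c ` V)"
    define B where "B = c ` V - {m}"
    define m' where "m' = Max B"
    have fin: "finite (c ` V)" "finite B" using assms(1) by (auto simp: B_def)
    have m: "m \<in> c ` V" "\<And>v. v \<in> V \<Longrightarrow> c v \<le> m" using ne fin by (auto simp: m_def)
    have B: "B \<noteq> {}" using False m(1) by (auto simp: B_def)
    have m': "m' \<in> B" "\<And>v. v \<in> V \<Longrightarrow> c v \<noteq> m \<Longrightarrow> c v \<le> m'"
      using Max_in[OF fin(2) B] Max_ge[OF fin(2)] by (auto simp: m'_def B_def)
    then have "m' < m" using m by (force simp: B_def)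
    let ?c = "\<lambda>v. min (c v) m'"
    have c_eq: "?c v = (if c v = m then m' else c v)" if "v \<in> V" for v
      using m'(2)[OF that] \<open>m' < m\<close> by auto
    have "?c ` V \<subseteq> B"
      using c_eq m'(1) by (auto simp: B_def)
    moreover have "B \<subset> c ` V" using m(1) by (auto simp: B_def)
    ultimately have "card (?c ` V) < card (c ` V)"
      by (meson fin(1) le_less_trans psubset_card_mono card_mono fin(2))
    \<comment> \<open>Sublevel sets of the truncation are sublevel sets of \<open>c\<close> or all
      of \<open>V\<close>, so the hypothesis persists.\<close>
    moreover have "sum d {v \<in> V. ?c v \<le> l} \<ge> 0" for l
    proof (cases "m' \<le> l")
      case True
      then have "{v \<in> V. ?c v \<le> l} = V" by auto
      then show ?thesis using assms(2) by simp
    next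
      case False
      then have "{v \<in> V. ?c v \<le> l} = {v \<in> V. c v \<le> l}" by auto
      then show ?thesis using less.prems[of l] by simp
    qed
    ultimately have IH: "(\<Sum>v\<in>V. ?c v * d v) \<le> 0" using less.hyps[of ?c] by blast
    \<comment> \<open>Truncation changes only the top level set, whose \<open>d\<close>-sum is minus
      a sublevel sum because \<open>d\<close> sums to zero.\<close>
    have "(\<Sum>v\<in>V. c v * d v) - (\<Sum>v\<in>V. ?c v * d v) = (\<Sum>v\<in>V. if c v = m then (m - m') * d v else 0)"
      unfolding sum_subtractf[symmetric]
      by (rule sum.cong) (auto simp: c_eq algebra_simps)
    also have "\<dots> = (m - m') * sum d {v \<in> V. c v = m}"
      using assms(1) by (auto simp: sum.inter_filter sum_distrib_left intro: sum.cong)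
    also have "sum d {v \<in> V. c v = m} = sum d V - sum d {v \<in> V. c v \<le> m'}"
    proof -
      have "{v \<in> V. c v \<le> m'} = V - {v \<in> V. c v = m}"
        using m'(2) \<open>m' < m\<close> by auto
      then show ?thesis using assms(1) by (simp add: sum_diff)
    qed
    also have "(m - m') * (sum d V - sum d {v \<in> V. c v \<le> m'}) \<le> 0"
      using assms(2) less.prems[of m'] \<open>m' < m\<close> by (simp add: mult_nonneg_nonneg)
    finally show ?thesis using IH by simp
  qed
qed

lemma graph_component_closed:
  assumes "K \<in> graph_components A" "(u, v) \<in> underlying A"
  shows "u \<in> K \<longleftrightarrow> v \<in> K"
proof -
  have "(v, u) \<in> underlying A" using assms(2) by (auto simp: underlying_def)
  with assms show ?thesis
    by (auto simp: graph_components_def quotient_def intro: rtrancl_into_rtrancl)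
qed

lemma equiv_underlying: "equiv UNIV ((underlying A)\<^sup>*)"
  using equiv_underlying_induced[of UNIV A] by (simp add: induced_def)

context skeletal_dag
begin

definition heads :: "real ^ 'v" where
  "heads = (\<Sum>(u, v)\<in>A. axis v 1)"

lemma inner_heads: "c \<bullet> heads = (\<Sum>a\<in>A. c $ snd a)"
  by (simp add: heads_def inner_sum_right case_prod_unfold inner_axis_1)

lemma mem_associahedron_H:
  "x \<in> associahedron_H A \<longleftrightarrow>
    (\<forall>K\<in>graph_components A. indicator_vec K \<bullet> x = indicator_vec K \<bullet> heads) \<and>
    (\<forall>U. biconnected A U \<and> connected_in (transitive_reduction A) U \<longrightarrow>
       real (arc_count A U) \<le> indicator_vec U \<bullet> x)"
proof -
  have "x \<in> {x + heads |x. x \<in> (component_space A)\<^sup>\<bottom>} \<longleftrightarrow> x - heads \<in> (component_space A)\<^sup>\<bottom>"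
    by (force intro: exI[of _ "x - heads"])
  also have "\<dots> \<longleftrightarrow> (\<forall>K\<in>graph_components A. indicator_vec K \<bullet> x = indicator_vec K \<bullet> heads)"
    unfolding component_space_def mem_orthogonal_comp_span by (auto simp: inner_diff_right)
  finally show ?thesis
    unfolding associahedron_H_def heads_def[symmetric] by auto
qed

lemma supp_in_component:
  assumes "K \<in> graph_components A" "(u, w) \<in> A" "t \<in> supp u w"
  shows "t \<in> K \<longleftrightarrow> w \<in> K"
proof (cases "t = w")
  case False
  then have "(t, w) \<in> underlying A" using supp_last assms by (auto simp: underlying_def)
  from graph_component_closed[OF assms(1) this] show ?thesis .
qed simp

lemma arc_count_eq:
  assumes "connected_in (transitive_reduction A) U"
  shows "arc_count A U = card {a \<in> A. supp (fst a) (snd a) \<subseteq> U}"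
proof -
  have "induced A U = {a \<in> A. supp (fst a) (snd a) \<subseteq> U}"
    using supp_subset_if_connected[OF assms] supp_ends by (fastforce simp: induced_def)
  then show ?thesis by (simp add: arc_count_def)
qed

text \<open>Each simplex lies in the coordinates of a single component, which gives the equations.
  On the simplex of an arc, \<open>indicator_vec U\<close> is at least 1 if the support is inside
  \<open>U\<close> and at least 0 otherwise.\<close>

lemma associahedron_M_subset_H: "associahedron_M A \<subseteq> associahedron_H A"
proof
  fix y assume "y \<in> associahedron_M A"
  then obtain f where f: "\<And>a. a \<in> A \<Longrightarrow> f a \<in> arc_simplex a" "y = (\<Sum>a\<in>A. f a)"
    using mem_associahedron_M by blast
  have "indicator_vec K \<bullet> y = indicator_vec K \<bullet> heads" if K: "K \<in> graph_components A" for K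
  proof -
    have "indicator_vec K \<bullet> f a = indicator_vec K $ snd a" if "a \<in> A" for a
    proof (rule inner_simplex_eq[OF f(1)[OF that]])
      show "indicator_vec K $ t = indicator_vec K $ snd a" if "t \<in> supp (fst a) (snd a)" for t
        using supp_in_component[OF K, of "fst a" "snd a" t] \<open>a \<in> A\<close> that
        by (simp add: indicator_vec_nth)
    qed
    then show ?thesis by (simp add: f(2) inner_heads inner_sum_right)
  qed
  moreover have "real (arc_count A U) \<le> indicator_vec U \<bullet> y"
    if U: "connected_in (transitive_reduction A) U" for U
  proof -
    have "(if supp (fst a) (snd a) \<subseteq> U then 1 else 0) \<le> indicator_vec U \<bullet> f a" if "a \<in> A" for a
      using inner_simplex_le[OF f(1)[OF that], of "- indicator_vec U"
          "- (if supp (fst a) (snd a) \<subseteq> U then 1 else 0)"]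
      by (auto simp: indicator_vec_nth subset_iff split: if_splits)
    then have "(\<Sum>a\<in>A. if supp (fst a) (snd a) \<subseteq> U then 1 else 0) \<le> indicator_vec U \<bullet> y"
      unfolding f(2) inner_sum_right by (rule sum_mono)
    then show ?thesis
      by (simp add: arc_count_eq[OF U] sum.If_cases Int_def)
  qed
  ultimately show "y \<in> associahedron_H A" by (simp add: mem_associahedron_H)
qed

text \<open>The sets whose inequality is tight at \<open>vert R\<close>: a support not inside
  \<open>U\<close> has its sink outside \<open>U\<close> and contributes nothing. Sublevel sets of
  functionals in the cone of \<open>R\<close> are of this kind.\<close>

definition sink_closed :: "'v digraph \<Rightarrow> 'v set \<Rightarrow> bool" where
  "sink_closed R U \<longleftrightarrow> (\<forall>(u, w)\<in>A. sink R u w \<in> U \<longrightarrow> supp u w \<subseteq> U)"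

lemma indicator_vec_vert:
  assumes R: "biclosed R" and U: "sink_closed R U"
  shows "indicator_vec U \<bullet> vert R = card {a \<in> A. supp (fst a) (snd a) \<subseteq> U}"
proof -
  have "indicator_vec U \<bullet> vert R = (\<Sum>a\<in>A. if supp (fst a) (snd a) \<subseteq> U then 1 else 0)"
    unfolding inner_vert
  proof (rule sum.cong[OF refl])
    fix a assume "a \<in> A"
    then show "indicator_vec U $ sink R (fst a) (snd a) = (if supp (fst a) (snd a) \<subseteq> U then 1 else 0)"
      using sink_in_supp[OF R, of "fst a" "snd a"] U
      by (auto simp: indicator_vec_nth sink_closed_def case_prod_unfold)
  qed
  then show ?thesis by (simp add: sum.If_cases Int_def)
qed

section \<open>Decomposition of sublevel sets into sets carrying an inequality\<close>

context
  fixes x :: "real ^ 'v" and R :: "'v digraph"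
  assumes x: "x \<in> associahedron_H A" and R: "biclosed R"
begin

text \<open>Additive over disjoint unions and zero on components of \<open>A\<close>, so that signs
  pass between a set, its pieces and its complement.\<close>

definition excess :: "'v set \<Rightarrow> real" where
  "excess U = (\<Sum>u\<in>U. (x - vert R) $ u)"

lemma excess_eq: "excess U = indicator_vec U \<bullet> x - indicator_vec U \<bullet> vert R"
  by (simp add: excess_def inner_indicator_vec sum_subtractf)

lemma excess_component:
  assumes "K \<in> graph_components A"
  shows "excess K = 0"
proof -
  have "vert R \<in> associahedron_H A"
    using associahedron_M_subset_H vert_in_associahedron_M[OF R] by blast
  then have "indicator_vec K \<bullet> x = indicator_vec K \<bullet> vert R"
    using x assms unfolding mem_associahedron_H by simp
  then show ?thesis by (simp add: excess_eq)
qed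

lemma excess_UNIV: "excess UNIV = 0"
proof -
  have "excess UNIV = (\<Sum>K\<in>graph_components A. excess K)"
    unfolding excess_def graph_components_def by (rule sum_quotient[OF finite equiv_underlying])
  then show ?thesis using excess_component by simp
qed

lemma excess_facet:
  assumes "biconnected A U" "connected_in (transitive_reduction A) U" "sink_closed R U"
  shows "excess U \<ge> 0"
proof -
  have "real (arc_count A U) \<le> indicator_vec U \<bullet> x"
    using x assms(1,2) unfolding mem_associahedron_H by blast
  then show ?thesis
    unfolding excess_eq indicator_vec_vert[OF R assms(3)] arc_count_eq[OF assms(2)] by simp
qed

lemma excess_Diff: "U \<subseteq> W \<Longrightarrow> excess (W - U) = excess W - excess U"
  unfolding excess_def by (rule sum_diff) auto

text \<open>For a connected component \<open>W\<close> of the complement of \<open>C\<close>, the set \<open>K - W\<close> defines one of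
  the inequalities, so \<open>excess W \<le> 0\<close>.\<close>

lemma excess_connected:
  assumes C: "C \<noteq> {}" "connected_in (transitive_reduction A) C" "sink_closed R C"
  shows "excess C \<ge> 0"
proof -
  let ?T = "transitive_reduction A"
  obtain t0 where t0: "t0 \<in> C" using C(1) by blast
  define K where "K = (underlying A)\<^sup>* `` {t0}"
  have K: "K \<in> graph_components A" by (auto simp: K_def graph_components_def quotient_def)
  have CK: "C \<subseteq> K"
  proof
    fix t assume "t \<in> C"
    then have "(t0, t) \<in> (underlying (induced ?T C))\<^sup>*"
      using C(2) t0 by (auto simp: connected_in_def)
    then have "(t0, t) \<in> (underlying (induced A UNIV))\<^sup>*"
      by (rule underlying_induced_rtrancl_mono) (use reduction_subset in auto)
    then show "t \<in> K" by (simp add: K_def induced_def)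
  qed
  have to_t0: "(t, t0) \<in> (underlying A)\<^sup>*" if "t \<in> K" for t
    using that underlying_induced_rtrancl_sym[of t0 t A UNIV] by (simp add: K_def induced_def)
  \<comment> \<open>Components are taken in \<open>A\<close>, not in its reduction: adjacent
    vertices outside \<open>C\<close> then share a component, which controls how supports meet
    \<open>W\<close>.\<close>
  define r where "r = (underlying (induced A (K - C)))\<^sup>* \<inter> (K - C) \<times> (K - C)"
  have "excess W \<le> 0" if "W \<in> (K - C) // r" for W
  proof -
    note W = induced_quotient_properties[OF that[unfolded r_def]]
    have Wclosed: "t \<in> W" if "s \<in> W" "t \<in> K - C" "(s, t) \<in> A \<or> (t, s) \<in> A" for s t
    proof (rule W(4)[OF that(1,2)])
      have "(s, t) \<in> underlying (induced A (K - C))"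
        using that W(1) by (auto simp: underlying_def induced_def)
      then show "(s, t) \<in> (underlying (induced A (K - C)))\<^sup>*" by blast
    qed
    have conn: "(t, t0) \<in> (underlying (induced ?T (K - W)))\<^sup>*" if "(t, t0) \<in> (underlying A)\<^sup>*" "t \<notin> W" for t
      using that
    proof (induction rule: converse_rtrancl_induct)
      case (step t t')
      show ?case
      proof (cases "t \<in> C")
        case True
        then have "(t, t0) \<in> (underlying (induced ?T C))\<^sup>*"
          using C(2) t0 by (auto simp: connected_in_def)
        then show ?thesis by (rule underlying_induced_rtrancl_mono) (use CK W(1) in auto)
      next
        case False
        have t'K: "t' \<in> K"
          using underlying_induced_rtrancl_sym[of t' t0 A UNIV] step(2) by (simp add: K_def induced_def)
        then have tK: "t \<in> K - C" using False graph_component_closed[OF K step(1)] by blast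
        have "t' \<notin> W" using Wclosed[of t' t] step.prems step(1) tK by (auto simp: underlying_def)
        then have IH: "(t', t0) \<in> (underlying (induced ?T (K - W)))\<^sup>*" using step.IH by blast
        obtain u w where uw: "(u, w) \<in> A" "t \<in> supp u w" "t' \<in> supp u w"
          using step(1) supp_ends by (auto simp: underlying_def)
        \<comment> \<open>A vertex of the support in \<open>W\<close> would be adjacent to
          \<open>t\<close>, which lies outside \<open>C\<close>, and would pull \<open>t\<close>
          into \<open>W\<close>. So the arc between \<open>t\<close> and \<open>t'\<close> can be
          replaced by a walk in its support, which is connected in the reduction.\<close>
        have sub: "supp u w \<subseteq> K - W"
        proof
          fix s assume s: "s \<in> supp u w"
          have "s \<in> K" using supp_in_component[OF K uw(1)] s uw(2) tK by blast
          moreover have "s \<notin> W"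
            using Wclosed[OF _ tK] supp_clique[OF uw(1) s uw(2)] step.prems by blast
          ultimately show "s \<in> K - W" by blast
        qed
        have "(t, t') \<in> (underlying (induced ?T (supp u w)))\<^sup>*"
          using supp_connected[OF uw(1)] uw by (auto simp: connected_in_def)
        from underlying_induced_rtrancl_mono[OF this subset_refl sub]
        have "(t, t') \<in> (underlying (induced ?T (K - W)))\<^sup>*" .
        with IH show ?thesis by simp
      qed
    qed simp
    have KW: "connected_in ?T (K - W)"
      unfolding connected_in_def
    proof (intro ballI)
      fix s t assume "s \<in> K - W" "t \<in> K - W"
      then show "(s, t) \<in> (underlying (induced ?T (K - W)))\<^sup>*"
        using conn to_t0 underlying_induced_rtrancl_sym by (meson DiffD1 DiffD2 rtrancl_trans)
    qed
    moreover have "biconnected A (K - W)"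
    proof -
      have "K - W \<noteq> {}" using t0 CK W(1) by blast
      moreover have "connected_in A (K - W)"
        using KW underlying_induced_rtrancl_mono[OF _ reduction_subset subset_refl] unfolding connected_in_def by blast
      moreover have "K - (K - W) = W" using W(1) by blast
      ultimately show ?thesis
        unfolding biconnected_def using K W(2,3) by (metis Diff_subset)
    qed
    \<comment> \<open>A vertex \<open>s\<close> of the support in \<open>W\<close> is adjacent to
      the sink, which is outside \<open>W\<close>; so the sink is in \<open>C\<close>, and
      sink-closedness of \<open>C\<close> puts \<open>s\<close> into \<open>C\<close>, a
      contradiction.\<close>
    moreover have "sink_closed R (K - W)"
      unfolding sink_closed_def
    proof clarify
      fix u w s assume uw: "(u, w) \<in> A" "sink R u w \<in> K" "sink R u w \<notin> W" and s: "s \<in> supp u w"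
      have sink: "sink R u w \<in> supp u w" using sink_in_supp[OF R uw(1)] .
      have "s \<in> K" using supp_in_component[OF K uw(1)] s sink uw(2) by blast
      moreover have "s \<notin> W"
      proof
        assume "s \<in> W"
        then have "sink R u w \<in> C"
          using Wclosed[of s "sink R u w"] supp_clique[OF uw(1) s sink] uw by blast
        then have "s \<in> C" using C(3) uw(1) s by (auto simp: sink_closed_def)
        then show False using \<open>s \<in> W\<close> W(1) by blast
      qed
      ultimately show "s \<in> K - W" by blast
    qed
    ultimately have "excess (K - W) \<ge> 0" using excess_facet by blast
    moreover have "excess (K - W) = - excess W"
      using excess_Diff[of W K] W(1) excess_component[OF K] by auto
    ultimately show ?thesis by simp
  qed
  moreover have "excess (K - C) = (\<Sum>W\<in>(K - C) // r. excess W)"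
    unfolding excess_def r_def by (intro sum_quotient equiv_underlying_induced) simp
  ultimately have "excess (K - C) \<le> 0" by (simp add: sum_nonpos)
  then show ?thesis using excess_Diff[OF CK] excess_component[OF K] by simp
qed

text \<open>The components of \<open>L\<close> in the reduction inherit sink-closedness: a support
  with sink in \<open>L\<close> lies in \<open>L\<close> and is connected in the reduction, hence
  stays in one component.\<close>

lemma excess_sink_closed:
  assumes L: "sink_closed R L"
  shows "excess L \<ge> 0"
proof -
  let ?T = "transitive_reduction A"
  define r where "r = (underlying (induced ?T L))\<^sup>* \<inter> L \<times> L"
  have "excess C \<ge> 0" if "C \<in> L // r" for C
  proof -
    note C = induced_quotient_properties[OF that[unfolded r_def]]
    have "sink_closed R C"
      unfolding sink_closed_def
    proof clarify
      fix u w s assume uw: "(u, w) \<in> A" "sink R u w \<in> C" and s: "s \<in> supp u w"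
      have sub: "supp u w \<subseteq> L" using L uw C(1) by (auto simp: sink_closed_def)
      have "(sink R u w, s) \<in> (underlying (induced ?T (supp u w)))\<^sup>*"
        using supp_connected[OF uw(1)] sink_in_supp[OF R uw(1)] s by (auto simp: connected_in_def)
      then have "(sink R u w, s) \<in> (underlying (induced ?T L))\<^sup>*"
        by (rule underlying_induced_rtrancl_mono) (use sub in auto)
      then show "s \<in> C" using C(4)[OF uw(2)] sub s by blast
    qed
    then show ?thesis using excess_connected C by blast
  qed
  moreover have "excess L = (\<Sum>C\<in>L // r. excess C)"
    unfolding excess_def r_def by (intro sum_quotient equiv_underlying_induced) simp
  ultimately show ?thesis by (simp add: sum_nonneg)
qed

text \<open>The sink maximises \<open>c\<close> on its support, so sublevel sets of \<open>c\<close>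
  are sink-closed and have nonnegative excess; Abel summation with \<open>d = x - vert R\<close>
  turns this into the inequality.\<close>

lemma inner_le_vert_H:
  assumes c: "c \<in> reorientation_cone A R"
  shows "c \<bullet> x \<le> c \<bullet> vert R"
proof -
  have "sink_closed R {v. c $ v \<le> l}" for l
    unfolding sink_closed_def using cone_le_sink[OF R c] order_trans by fastforce
  then have "excess {v. c $ v \<le> l} \<ge> 0" for l using excess_sink_closed by blast
  then have "(\<Sum>v\<in>UNIV. c $ v * (x - vert R) $ v) \<le> 0"
    using excess_UNIV by (intro sum_mult_nonpos_if_level_sums_nonneg) (simp_all add: excess_def)
  then have "c \<bullet> (x - vert R) \<le> 0" by (simp add: inner_vec_def)
  then show ?thesis by (simp add: inner_diff_right)
qed

end

lemma associahedron_H_subset_M: "associahedron_H A \<subseteq> associahedron_M A"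
proof
  fix x assume x: "x \<in> associahedron_H A"
  show "x \<in> associahedron_M A"
  proof (rule ccontr)
    assume "x \<notin> associahedron_M A"
    then obtain c b where cb: "c \<bullet> x < b" "\<And>y. y \<in> associahedron_M A \<Longrightarrow> b < c \<bullet> y"
      using separating_hyperplane_closed_point[of "associahedron_M A" x]
        polytope_imp_convex polytope_imp_closed polytope_associahedron_M by blast
    \<comment> \<open>Separation puts \<open>x\<close> on the low side of \<open>c\<close>, whereas
      the vertex bound is about maxima; hence the cone containing \<open>- c\<close>.\<close>
    obtain R where R: "biclosed R" "- c \<in> reorientation_cone A R" using ex_reorientation_cone by blast
    show False
      using inner_le_vert_H[OF x R] cb(1) cb(2)[OF vert_in_associahedron_M[OF R(1)]] by simp
  qed
qed

end

theorem proposition62: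
  fixes A :: "'v::finite digraph"
  assumes "acyclic A"
    and "skeletal A"
  shows "associahedron_H A = associahedron_M A \<and>
    polytope (associahedron_M A) \<and>
    sylvester_fan A = normal_fan (associahedron_M A)"
proof -
  interpret skeletal_dag A using assms by unfold_locales
  have "associahedron_H A = associahedron_M A"
    by (rule Set.equalityI[OF associahedron_H_subset_M associahedron_M_subset_H])
  then show ?thesis
    by (intro conjI polytope_associahedron_M sylvester_fan_eq)
qed

end
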